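(* Let $\alpha,\beta,\gamma_1,\gamma_2\in\widehat{\kappa^\times}$ with $\alpha,\beta\notin\{\varepsilon,\gamma_1,\gamma_2\}$. Put $J=j(\alpha,\overline{\alpha}\gamma_1)\,j(\beta,\overline{\beta}\gamma_2)$. Then, for any $x,y\in\kappa^\times\setminus\{1\}$, $$J\cdot F_4(\alpha;\beta;\gamma_1,\gamma_2;x(1-y),y(1-x))$$ $$=\sum_{u,v\in\kappa^\times}\alpha(u)\beta(v)\,\overline{\alpha}\gamma_1(1-u)\,\overline{\beta}\gamma_2(1-v)\,\alpha\overline{\gamma_1\gamma_2}(1-xu)\,\beta\overline{\gamma_1\gamma_2}(1-yv)\,\overline{\alpha\beta}\gamma_1\gamma_2(1-xu-yv)$$ $$-S_0(x,y)-S_1(x,y)-S_2(x,y),$$ where $$S_0(x,y)=\alpha\beta(-1)\,j(\alpha\overline{\gamma_2},\beta\overline{\gamma_1})\,\overline{\gamma_1}(x)\,\overline{\gamma_2}(y),$$ $$S_1(x,y)=j(\overline{\alpha\beta}\gamma_1\gamma_2,\beta)\,\overline{\gamma_1}(x)\,\overline{\alpha}\gamma_1(x-1)\,\overline{\beta}(y),$$ $$S_2(x,y)=j(\overline{\alpha\beta}\gamma_1\gamma_2,\alpha)\,\overline{\gamma_2}(y)\,\overline{\beta}\gamma_2(y-1)\,\overline{\alpha}(x).$$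
   Context: $\kappa$ is a finite field with $q$ elements of characteristic $p$. $\widehat{\kappa^\times}=\mathrm{Hom}(\kappa^\times,\overline{\mathbb{Q}}^\times)$ is the group of multiplicative characters, $\varepsilon$ the trivial character, $\overline{\eta}=\eta^{-1}$; every $\eta\in\widehat{\kappa^\times}$ (including $\varepsilon$) is extended to $\kappa$ by $\eta(0)=0$. A product of characters followed by an argument means the product character evaluated there, e.g. $\overline{\alpha\beta}\gamma_1\gamma_2(z)=(\alpha^{-1}\beta^{-1}\gamma_1\gamma_2)(z)$. $\delta(\eta)=1$ if $\eta=\varepsilon$ and $0$ otherwise. Fix a non-trivial additive character $\psi\in\mathrm{Hom}(\kappa,\overline{\mathbb{Q}}^\times)$. Put $$g(\eta)=-\sum_{x\in\kappa^\times}\psi(x)\eta(x),\quad g^\circ(\eta)=q^{\delta(\eta)}g(\eta),\quad j(\eta_1,\eta_2)=-\sum_{x_1,x_2\in\kappa^\times,\ x_1+x_2=1}\eta_1(x_1)\eta_2(x_2),$$ $$(\alpha)_\nu=\frac{g(\alpha\nu)}{g(\alpha)},\qquad(\alpha)_\nu^\circ=\frac{g^\circ(\alpha\nu)}{g^\circ(\alpha)}.$$ For $\lambda_1,\lambda_2\in\kappa$, $$F_4(\alpha;\beta;\gamma_1,\gamma_2;\lambda_1,\lambda_2)=\frac{1}{(1-q)^2}\sum_{\nu_1,\nu_2\in\widehat{\kappa^\times}}\frac{(\alpha)_{\nu_1\nu_2}(\beta)_{\nu_1\nu_2}}{(\gamma_1)^\circ_{\nu_1}(\gamma_2)^\circ_{\nu_2}(\varepsilon)^\circ_{\nu_1}(\varepsilon)^\circ_{\nu_2}}\nu_1(\lambda_1)\nu_2(\lambda_2).$$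 *)

theory Defs
  imports "HOL-Algebra.Algebraic_Closure_Type" "HOL-Library.Cardinality" "HOL-Library.Function_Division"
begin

text \<open>
  The finite field is a type \<open>'a :: {field, finite}\<close> with \<open>q = CARD('a)\<close> elements.
  Characters are functions on all of \<open>'a\<close>; products and inverses of multiplicative
  characters are the pointwise ones on functions. Since \<open>inverse 0 = 0\<close>, these respect
  the convention that every multiplicative character vanishes at \<open>0\<close>.
\<close>

type_synonym qbar = "rat alg_closure"

definition mult_chars :: "('a::{field,finite} \<Rightarrow> qbar) set" where
  "mult_chars = {\<eta>. \<eta> 0 = 0 \<and> (\<forall>x. x \<noteq> 0 \<longrightarrow> \<eta> x \<noteq> 0) \<and>
     (\<forall>x y. x \<noteq> 0 \<longrightarrow> y \<noteq> 0 \<longrightarrow> \<eta> (x * y) = \<eta> x * \<eta> y)}"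

text \<open>The unit of the character group; not the constant function \<open>1\<close>, as it is \<open>0\<close> at \<open>0\<close>.\<close>

definition triv_char :: "'a::{field,finite} \<Rightarrow> qbar" where
  "triv_char x = (if x = 0 then 0 else 1)"

definition additive_char :: "('a::{field,finite} \<Rightarrow> qbar) \<Rightarrow> bool" where
  "additive_char \<psi> \<longleftrightarrow> (\<forall>x. \<psi> x \<noteq> 0) \<and> (\<forall>x y. \<psi> (x + y) = \<psi> x * \<psi> y)"

definition nontriv_additive_char :: "('a::{field,finite} \<Rightarrow> qbar) \<Rightarrow> bool" where
  "nontriv_additive_char \<psi> \<longleftrightarrow> additive_char \<psi> \<and> (\<exists>x. \<psi> x \<noteq> 1)"

definition char_delta :: "('a::{field,finite} \<Rightarrow> qbar) \<Rightarrow> nat" where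
  "char_delta \<eta> = (if \<eta> = triv_char then 1 else 0)"

definition gauss :: "('a::{field,finite} \<Rightarrow> qbar) \<Rightarrow> ('a \<Rightarrow> qbar) \<Rightarrow> qbar" where
  "gauss \<psi> \<eta> = - (\<Sum>x\<in>UNIV - {0}. \<psi> x * \<eta> x)"

definition gauss_circ :: "('a::{field,finite} \<Rightarrow> qbar) \<Rightarrow> ('a \<Rightarrow> qbar) \<Rightarrow> qbar" where
  "gauss_circ \<psi> \<eta> = of_nat CARD('a) ^ char_delta \<eta> * gauss \<psi> \<eta>"

definition jacobi :: "('a::{field,finite} \<Rightarrow> qbar) \<Rightarrow> ('a \<Rightarrow> qbar) \<Rightarrow> qbar" where
  "jacobi \<eta>\<^sub>1 \<eta>\<^sub>2 =
     - (\<Sum>(x\<^sub>1, x\<^sub>2) \<in> {(x\<^sub>1, x\<^sub>2). x\<^sub>1 \<noteq> 0 \<and> x\<^sub>2 \<noteq> 0 \<and> x\<^sub>1 + x\<^sub>2 = 1}. \<eta>\<^sub>1 x\<^sub>1 * \<eta>\<^sub>2 x\<^sub>2)"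

definition poch :: "('a::{field,finite} \<Rightarrow> qbar) \<Rightarrow> ('a \<Rightarrow> qbar) \<Rightarrow> ('a \<Rightarrow> qbar) \<Rightarrow> qbar" where
  "poch \<psi> \<alpha> \<nu> = gauss \<psi> (\<alpha> * \<nu>) / gauss \<psi> \<alpha>"

definition poch_circ :: "('a::{field,finite} \<Rightarrow> qbar) \<Rightarrow> ('a \<Rightarrow> qbar) \<Rightarrow> ('a \<Rightarrow> qbar) \<Rightarrow> qbar" where
  "poch_circ \<psi> \<alpha> \<nu> = gauss_circ \<psi> (\<alpha> * \<nu>) / gauss_circ \<psi> \<alpha>"

definition F4 ::
  "('a::{field,finite} \<Rightarrow> qbar) \<Rightarrow> ('a \<Rightarrow> qbar) \<Rightarrow> ('a \<Rightarrow> qbar) \<Rightarrow> ('a \<Rightarrow> qbar) \<Rightarrow> ('a \<Rightarrow> qbar)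
     \<Rightarrow> 'a \<Rightarrow> 'a \<Rightarrow> qbar" where
  "F4 \<psi> \<alpha> \<beta> \<gamma>\<^sub>1 \<gamma>\<^sub>2 z\<^sub>1 z\<^sub>2 =
     1 / (1 - of_nat CARD('a)) ^ 2 *
     (\<Sum>\<nu>\<^sub>1\<in>mult_chars. \<Sum>\<nu>\<^sub>2\<in>mult_chars.
        (poch \<psi> \<alpha> (\<nu>\<^sub>1 * \<nu>\<^sub>2) * poch \<psi> \<beta> (\<nu>\<^sub>1 * \<nu>\<^sub>2)) /
        (poch_circ \<psi> \<gamma>\<^sub>1 \<nu>\<^sub>1 * poch_circ \<psi> \<gamma>\<^sub>2 \<nu>\<^sub>2 *
         poch_circ \<psi> triv_char \<nu>\<^sub>1 * poch_circ \<psi> triv_char \<nu>\<^sub>2) *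
        \<nu>\<^sub>1 z\<^sub>1 * \<nu>\<^sub>2 z\<^sub>2)"

text \<open>The sums over all characters are genuine finite sums.\<close>

lemma finite_mult_chars: "finite (mult_chars :: ('a::{field,finite} \<Rightarrow> qbar) set)"
proof -
  have ex: "\<exists>k>0. x ^ k = 1" if "x \<noteq> 0" for x :: 'a
  proof -
    have "\<not> inj (\<lambda>n::nat. x ^ n)"
      using finite_imageD[of "\<lambda>n::nat. x ^ n" UNIV] by auto
    then obtain m n where mn: "m < n" "x ^ m = x ^ n"
      unfolding inj_def by (metis linorder_neqE_nat)
    then have "x ^ m * x ^ (n - m) = x ^ m * 1"
      using power_add[of x m "n - m"] by simp
    then have "x ^ (n - m) = 1" using that by simp
    with mn show ?thesis by (intro exI[of _ "n - m"]) auto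
  qed
  define k where "k x = (SOME k. k > 0 \<and> x ^ k = 1)" for x :: 'a
  have k: "k x > 0 \<and> x ^ k x = 1" if "x \<noteq> 0" for x
    unfolding k_def using ex[OF that] by (rule someI_ex)
  define S where "S x = (if x = 0 then {0} else {z::qbar. z ^ k x = 1})" for x
  have "finite {z::qbar. z ^ n = 1}" if "n > 0" for n
  proof -
    have "poly (monom (1::qbar) n - 1) 0 \<noteq> 0"
      using that by (simp add: poly_monom power_0_left)
    then have "monom (1::qbar) n - 1 \<noteq> 0" by fastforce
    from poly_roots_finite[OF this] show ?thesis by (simp add: poly_monom)
  qed
  then have "finite (S x)" for x
    using k[of x] by (auto simp: S_def)
  then have "finite (Pi\<^sub>E (UNIV :: 'a set) S)" by (intro finite_PiE) auto
  moreover have "mult_chars \<subseteq> Pi\<^sub>E UNIV S"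
  proof (rule subsetI)
    fix \<eta> :: "'a \<Rightarrow> qbar" assume \<eta>: "\<eta> \<in> mult_chars"
    have one: "\<eta> 1 = 1"
    proof -
      have "\<eta> (1 * 1) = \<eta> 1 * \<eta> 1" "\<eta> 1 \<noteq> 0"
        using \<eta> one_neq_zero unfolding mult_chars_def by blast+
      then show ?thesis by simp
    qed
    have pow: "\<eta> (x ^ n) = \<eta> x ^ n" if "x \<noteq> 0" for x n
      using that \<eta> by (induction n) (auto simp: one mult_chars_def)
    have "\<eta> x \<in> S x" for x
      using \<eta> pow[of x "k x"] k[of x] one by (auto simp: S_def mult_chars_def)
    then show "\<eta> \<in> Pi\<^sub>E UNIV S" by auto
  qed
  ultimately show ?thesis by (rule finite_subset[rotated])
qed

end

theory Submission
  imports Defs "HOL-Algebra.Multiplicative_Group"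
begin

text \<open>
  The proof replaces every Gauss sum by its definition and performs all summations but two.

  By the reflection formula \<open>gauss \<psi> (inverse \<eta>) * gauss_circ \<psi> \<eta> = q \<eta> (-1)\<close>, dividing by the
  \<open>gauss_circ\<close> factors in \<open>F4\<close> amounts to multiplying by Gauss sums of inverse characters.
  Orthogonality of characters then removes the sums over \<open>\<nu>\<^sub>1\<close> and \<open>\<nu>\<^sub>2\<close> and leaves a sum over four
  field variables \<open>s\<close>, \<open>t\<close>, \<open>c\<close>, \<open>d\<close> of
  \<open>\<alpha> s * \<beta> t / (\<gamma>\<^sub>1 c * \<gamma>\<^sub>2 d)\<close> times \<open>\<psi>\<close> of
  \<open>s + t + c + d + s t z\<^sub>1 / c + s t z\<^sub>2 / d\<close> (\<open>F4_eq_kloosterman_sum\<close>).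

  For \<open>z\<^sub>1 = x (1 - y)\<close> and \<open>z\<^sub>2 = y (1 - x)\<close> the substitution \<open>s = c S / x\<close>, \<open>t = d T / y\<close> makes the
  exponent linear in \<open>c\<close> and \<open>d\<close>. Since \<open>\<alpha> \<noteq> \<gamma>\<^sub>1\<close> and \<open>\<beta> \<noteq> \<gamma>\<^sub>2\<close>, the sums over \<open>c\<close> and \<open>d\<close> are Gauss
  sums of non-trivial characters at the two linear coefficients
  (\<open>kloosterman_sum_eq_reduced_sum\<close>). The Jacobi sums in \<open>J\<close>, again products of Gauss sums,
  cancel all constants up to a sign. So \<open>J * F4\<close> is \<open>\<alpha> (-1) \<beta> (-1) / (\<alpha> x * \<beta> y)\<close> times the sum over
  non-zero \<open>S\<close>, \<open>T\<close> of
  \<open>\<alpha> S * \<beta> T * (\<gamma>\<^sub>1 / \<alpha>) (1 - S T + S (1 + T) / x) * (\<gamma>\<^sub>2 / \<beta>) (1 - S T + T (1 + S) / y)\<close>.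

  The birational map \<open>S = - x u / (1 - y v)\<close>, \<open>T = - y v / (1 - x u)\<close> carries the \<open>(u, v)\<close>-sum of the
  theorem to this sum restricted to \<open>S \<noteq> -1\<close>, \<open>T \<noteq> -1\<close>, \<open>S T \<noteq> 1\<close>
  (\<open>reduced_term_substitution\<close>, \<open>sum_birational_substitution\<close>). The three curves that it misses
  contribute one Jacobi sum each: \<open>S T = 1\<close> gives \<open>- S\<^sub>0\<close>, \<open>S = -1\<close> gives \<open>- S\<^sub>1\<close> and \<open>T = -1\<close>
  gives \<open>- S\<^sub>2\<close>. Their common point \<open>(-1, -1)\<close> contributes nothing, because there the linear
  coefficients are \<open>0\<close>.
\<close>

section \<open>The group of multiplicative characters\<close>

lemma mult_char_0: "\<eta> \<in> mult_chars \<Longrightarrow> \<eta> 0 = 0"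
  by (simp add: mult_chars_def)

lemma mult_char_nonzero: "\<eta> \<in> mult_chars \<Longrightarrow> x \<noteq> 0 \<Longrightarrow> \<eta> x \<noteq> 0"
  by (simp add: mult_chars_def)

lemma mult_char_mult: "\<eta> \<in> mult_chars \<Longrightarrow> \<eta> (x * y) = \<eta> x * \<eta> y"
  by (cases "x = 0 \<or> y = 0") (auto simp: mult_chars_def)

lemma mult_char_1: "\<eta> \<in> mult_chars \<Longrightarrow> \<eta> 1 = 1"
  using mult_char_mult[of \<eta> 1 1] mult_char_nonzero[of \<eta> 1] by simp

lemma mult_char_inverse: "\<eta> \<in> mult_chars \<Longrightarrow> \<eta> (inverse x) = inverse (\<eta> x)"
  using mult_char_mult[of \<eta> x "inverse x"] mult_char_nonzero[of \<eta> x]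
    mult_char_0[of \<eta>] mult_char_1[of \<eta>]
  by (cases "x = 0") (auto simp: field_simps)

lemma mult_char_divide: "\<eta> \<in> mult_chars \<Longrightarrow> \<eta> (x / y) = \<eta> x / \<eta> y"
  by (simp add: divide_inverse mult_char_mult mult_char_inverse)

lemma mult_char_power: "\<eta> \<in> mult_chars \<Longrightarrow> \<eta> (x ^ n) = \<eta> x ^ n"
  using mult_char_1[of \<eta>] by (induction n) (simp_all add: mult_char_mult)

lemma mult_char_minus: "\<eta> \<in> mult_chars \<Longrightarrow> \<eta> (- x) = \<eta> (- 1) * \<eta> x"
  using mult_char_mult[of \<eta> "- 1" x] by simp

lemma mult_char_minus_1_square: "\<eta> \<in> mult_chars \<Longrightarrow> \<eta> (- 1) * \<eta> (- 1) = 1"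
  using mult_char_mult[of \<eta> "- 1" "- 1"] mult_char_1[of \<eta>] by simp

lemma triv_char_mult_chars [intro, simp]: "triv_char \<in> mult_chars"
  by (simp add: mult_chars_def triv_char_def)

lemma mult_chars_times [intro, simp]:
  "\<eta> \<in> mult_chars \<Longrightarrow> \<chi> \<in> mult_chars \<Longrightarrow> \<eta> * \<chi> \<in> mult_chars"
  by (auto simp: mult_chars_def)

lemma mult_chars_inverse [intro, simp]: "\<eta> \<in> mult_chars \<Longrightarrow> inverse \<eta> \<in> mult_chars"
  by (auto simp: mult_chars_def)

lemma triv_char_times: "\<eta> \<in> mult_chars \<Longrightarrow> triv_char * \<eta> = \<eta>"
  using mult_char_0[of \<eta>] by (auto simp: triv_char_def fun_eq_iff)

lemma inverse_times_self: "\<eta> \<in> mult_chars \<Longrightarrow> inverse \<eta> * \<eta> = triv_char"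
  using mult_char_0[of \<eta>] by (auto simp: triv_char_def fun_eq_iff mult_char_nonzero)

lemma inverse_times_eq_triv_char_iff:
  assumes "\<eta> \<in> mult_chars" "\<chi> \<in> mult_chars"
  shows "inverse \<eta> * \<chi> = triv_char \<longleftrightarrow> \<chi> = \<eta>"
proof
  assume *: "inverse \<eta> * \<chi> = triv_char"
  show "\<chi> = \<eta>"
  proof
    fix x
    show "\<chi> x = \<eta> x"
      using fun_cong[OF *, of x] assms mult_char_nonzero[of \<eta> x] mult_char_0[of \<eta>] mult_char_0[of \<chi>]
      by (cases "x = 0") (auto simp: triv_char_def field_simps)
  qed
qed (use assms inverse_times_self in auto)

lemma sum_mult_char:
  fixes \<eta> :: "'a::{field,finite} \<Rightarrow> qbar"
  assumes "\<eta> \<in> mult_chars" "\<eta> \<noteq> triv_char"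
  shows "(\<Sum>x\<in>UNIV - {0}. \<eta> x) = 0"
proof -
  from assms obtain a where a: "a \<noteq> 0" "\<eta> a \<noteq> 1"
    by (auto simp: fun_eq_iff triv_char_def mult_char_0[OF assms(1)] split: if_splits)
  have "(\<Sum>x\<in>UNIV - {0}. \<eta> x) = (\<Sum>x\<in>UNIV - {0}. \<eta> (a * x))"
    by (rule sum.reindex_bij_witness[of _ "\<lambda>x. a * x" "\<lambda>x. x / a"]) (use a in auto)
  also have "\<dots> = \<eta> a * (\<Sum>x\<in>UNIV - {0}. \<eta> x)"
    using assms by (simp add: mult_char_mult sum_distrib_left)
  finally show ?thesis using a by simp
qed

lemma power_card_units:
  fixes g :: "'a::{field,finite}"
  assumes "g \<noteq> 0"
  shows "g ^ (CARD('a) - 1) = 1"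
proof -
  have "(\<Prod>x\<in>UNIV - {0}. x) = (\<Prod>x\<in>UNIV - {0}. g * x)"
    by (rule prod.reindex_bij_witness[of _ "\<lambda>x. g * x" "\<lambda>x. x / g"]) (use assms in auto)
  also have "\<dots> = g ^ (CARD('a) - 1) * (\<Prod>x\<in>UNIV - {0}. x)"
    by (simp add: prod.distrib card_Diff_singleton)
  finally show ?thesis by simp
qed

text \<open>
  Exponents below \<open>q - 1\<close> already reach every unit, and there are exactly \<open>q - 1\<close> units, so
  each unit has a unique discrete logarithm in this range.
\<close>

lemma finite_field_generator:
  obtains g :: "'a::{field,finite}"
  where "g \<noteq> 0" "bij_betw (\<lambda>i. g ^ i) {..<CARD('a) - 1} (UNIV - {0})"
proof -
  let ?R = "ring_of_type_algebra :: 'a ring"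
  have pow: "x [^]\<^bsub>?R\<^esub> (i::nat) = x ^ i" for x :: 'a and i
    by (induction i) (auto simp: ring_of_type_algebra_def nat_pow_def)
  obtain g :: 'a where g: "g \<in> carrier (mult_of ?R)"
     "carrier (mult_of ?R) = {g [^]\<^bsub>?R\<^esub> i | i::nat. i \<in> UNIV}"
    using field.finite_field_mult_group_has_gen[of ?R, OF field_from_type_algebra]
    by (auto simp: ring_of_type_algebra_def)
  have "carrier (mult_of ?R) = UNIV - {0}"
    by (simp add: ring_of_type_algebra_def)
  with g have g0: "g \<noteq> 0" and gen: "UNIV - {0} = {g ^ i | i. i \<in> UNIV}"
    by (auto simp: pow)
  let ?n = "CARD('a) - 1"
  have n: "?n = card (UNIV - {0 :: 'a})"
    by (simp add: card_Diff_singleton)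
  have "UNIV - {0 :: 'a} \<noteq> {}" using one_neq_zero[where 'a = 'a] by blast
  hence n0: "?n > 0" by (metis n card_gt_0_iff finite)
  have img: "(\<lambda>i. g ^ i) ` {..<?n} = UNIV - {0}"
  proof (intro equalityI subsetI)
    fix x :: 'a assume "x \<in> UNIV - {0}"
    then obtain i where x: "x = g ^ i" using gen by auto
    have "g ^ i = (g ^ ?n) ^ (i div ?n) * g ^ (i mod ?n)"
      by (simp flip: power_mult power_add)
    hence "x = g ^ (i mod ?n)"
      using x by (simp only: power_card_units[OF g0] power_one mult_1_left)
    with n0 show "x \<in> (\<lambda>i. g ^ i) ` {..<?n}" by auto
  qed (use g0 in auto)
  have "inj_on (\<lambda>i. g ^ i) {..<?n}"
    by (rule eq_card_imp_inj_on) (simp, metis img card_lessThan n)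
  with img g0 that show ?thesis by (auto simp: bij_betw_def)
qed

text \<open>
  The polynomial \<open>X ^ n - 1\<close> splits over the algebraically closed field \<open>qbar\<close>, and in
  characteristic zero it has no root in common with its derivative \<open>n X ^ (n - 1)\<close>.
\<close>

lemma card_roots_of_unity_qbar:
  assumes "n > 0"
  shows "card {w :: qbar. w ^ n = 1} = n"
proof -
  define p where "p = monom (1 :: qbar) n - 1"
  have poly_p: "poly p w = w ^ n - 1" for w
    by (simp add: p_def poly_monom)
  have deg: "degree p = n"
    using degree_add_eq_left[of "- 1" "monom (1 :: qbar) n"] assms
    by (simp add: p_def degree_monom_eq)
  have p0: "p \<noteq> 0" using deg assms by auto
  have "rsquarefree p"
    unfolding rsquarefree_roots p_def using assms
    by (auto simp: pderiv_diff pderiv_monom poly_monom power_0_left)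
  hence order: "order a p = 1" if "poly p a = 0" for a
    using that p0 by (simp add: rsquarefree_root_order)
  obtain A where A: "size A = degree p" "p = smult (lead_coeff p) (\<Prod>x\<in>#A. [:-x, 1:])"
    using alg_closed_imp_factorization[OF p0] by blast
  have "(\<Prod>x\<in>#B. [:-x, 1:]) \<noteq> 0" for B :: "qbar multiset"
    by (auto simp: prod_mset_zero_iff)
  hence "proots (\<Prod>x\<in>#B. [:-x, 1:]) = B" for B :: "qbar multiset"
    by (induction B) (simp_all add: proots_mult del: mult_pCons_left)
  hence "proots p = A"
    by (subst A(2)) (simp add: p0)
  hence "n = size (proots p)" using A(1) deg by simp
  also have "\<dots> = (\<Sum>x | poly p x = 0. order x p)"
    using p0 by (simp add: size_multiset_overloaded_eq)
  also have "\<dots> = (\<Sum>x | poly p x = 0. 1)"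
    by (intro sum.cong refl order) simp
  finally show ?thesis by (simp add: poly_p)
qed

text \<open>
  A character is determined by its value at a generator, and every root of unity of order
  dividing \<open>q - 1\<close> occurs: send \<open>g ^ i\<close> to \<open>w ^ i\<close>. Together with the count of roots of unity
  this gives both the size of the character group and enough characters to separate points.
\<close>

lemma mult_char_of_root_of_unity:
  fixes g :: "'a::{field,finite}"
  assumes g: "g \<noteq> 0" "bij_betw (\<lambda>i. g ^ i) {..<CARD('a) - 1} (UNIV - {0})"
    and w: "w ^ (CARD('a) - 1) = 1"
  shows "\<exists>\<chi>\<in>mult_chars. \<chi> g = w"
proof -
  let ?n = "CARD('a) - 1"
  define l where "l = the_inv_into {..<?n} (\<lambda>i. g ^ i)"
  have l: "l x < ?n" "g ^ l x = x" if "x \<noteq> 0" for x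
    using that bij_betwE[OF bij_betw_the_inv_into[OF g(2)]] f_the_inv_into_f_bij_betw[OF g(2)]
    by (auto simp: l_def)
  have w0: "w \<noteq> 0" using w l(1)[of 1] by (cases "w = 0") (auto simp: power_0_left split: if_splits)
  have l_eq: "w ^ l x = w ^ i" if "x = g ^ i" for x i
  proof -
    have x: "x \<noteq> 0" using that g by auto
    have red: "h ^ i = h ^ (i mod ?n)" if "h ^ ?n = 1" for h :: "'b :: monoid_mult"
    proof -
      have "h ^ i = (h ^ ?n) ^ (i div ?n) * h ^ (i mod ?n)"
        by (simp flip: power_mult power_add)
      thus ?thesis by (simp only: that power_one mult_1_left)
    qed
    have "?n > 0" using l(1)[OF x] by linarith
    moreover have "g ^ l x = g ^ (i mod ?n)"
      using l(2)[OF x] that red[OF power_card_units[OF g(1)]] by simp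
    ultimately have "l x = i mod ?n"
      using l(1)[OF x] bij_betw_imp_inj_on[OF g(2)] by (auto dest!: inj_onD)
    thus ?thesis using red[OF w] by simp
  qed
  define \<chi> where "\<chi> x = (if x = 0 then 0 else w ^ l x)" for x
  have "w ^ l (x * y) = w ^ l x * w ^ l y" if "x \<noteq> 0" "y \<noteq> 0" for x y
    using l_eq[of "x * y" "l x + l y"] l(2)[OF that(1)] l(2)[OF that(2)] by (simp add: power_add)
  hence "\<chi> \<in> mult_chars"
    using w0 by (simp add: mult_chars_def \<chi>_def)
  moreover have "\<chi> g = w" using l_eq[of g 1] g by (simp add: \<chi>_def)
  ultimately show ?thesis by blast
qed

lemma card_mult_chars: "card (mult_chars :: ('a::{field,finite} \<Rightarrow> qbar) set) = CARD('a) - 1"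
proof -
  obtain g :: 'a where g: "g \<noteq> 0" "bij_betw (\<lambda>i. g ^ i) {..<CARD('a) - 1} (UNIV - {0})"
    by (rule finite_field_generator)
  have "bij_betw (\<lambda>\<nu>. \<nu> g) (mult_chars :: ('a \<Rightarrow> qbar) set) {w. w ^ (CARD('a) - 1) = 1}"
    unfolding bij_betw_def
  proof
    show "inj_on (\<lambda>\<nu>. \<nu> g) (mult_chars :: ('a \<Rightarrow> qbar) set)"
    proof (rule inj_onI, rule ext)
      fix \<nu> \<mu> :: "'a \<Rightarrow> qbar" and x
      assume *: "\<nu> \<in> mult_chars" "\<mu> \<in> mult_chars" "\<nu> g = \<mu> g"
      show "\<nu> x = \<mu> x"
      proof (cases "x = 0")
        case False
        then obtain i where "x = g ^ i" using bij_betw_imp_surj_on[OF g(2)] by blast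
        with * show ?thesis by (simp add: mult_char_power)
      qed (use * mult_char_0 in metis)
    qed
    show "(\<lambda>\<nu>. \<nu> g) ` mult_chars = {w. w ^ (CARD('a) - 1) = 1}"
      using mult_char_of_root_of_unity[OF g] power_card_units[OF g(1)]
      by (auto simp: mult_char_power[symmetric] mult_char_1)
  qed
  moreover have "CARD('a) - 1 > 0"
    using card_gt_0_iff[of "UNIV - {0::'a}"] one_neq_zero[where 'a = 'a]
    by (auto simp: card_Diff_singleton simp del: one_neq_zero)
  ultimately show ?thesis
    by (simp add: bij_betw_same_card card_roots_of_unity_qbar)
qed

text \<open>
  If \<open>z = g ^ k\<close> with \<open>0 < k < q - 1\<close>, there are more \<open>(q - 1)\<close>-th roots of unity than \<open>k\<close>-th
  ones, so some character sends \<open>g\<close> to a root of unity \<open>w\<close> with \<open>w ^ k \<noteq> 1\<close>.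
\<close>

lemma mult_chars_separate_points:
  fixes z :: "'a::{field,finite}"
  assumes "z \<noteq> 0" "z \<noteq> 1"
  obtains \<chi> :: "'a \<Rightarrow> qbar" where "\<chi> \<in> mult_chars" "\<chi> z \<noteq> 1"
proof -
  let ?n = "CARD('a) - 1"
  obtain g :: 'a where g: "g \<noteq> 0" "bij_betw (\<lambda>i. g ^ i) {..<?n} (UNIV - {0})"
    by (rule finite_field_generator)
  obtain k where k: "k < ?n" "z = g ^ k"
    using bij_betw_imp_surj_on[OF g(2)] assms by blast
  have "k > 0" using k assms by (cases k) auto
  have "card {w :: qbar. w ^ k = 1} < card {w :: qbar. w ^ ?n = 1}"
    using \<open>k > 0\<close> k by (simp add: card_roots_of_unity_qbar)
  moreover have "finite {w :: qbar. w ^ k = 1}"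
    using card_roots_of_unity_qbar[OF \<open>k > 0\<close>] \<open>k > 0\<close> by (intro card_ge_0_finite) simp
  ultimately obtain w :: qbar where "w ^ ?n = 1" "w ^ k \<noteq> 1"
    using card_mono[of "{w :: qbar. w ^ k = 1}" "{w. w ^ ?n = 1}"] by force
  with mult_char_of_root_of_unity[OF g] that k(2) show ?thesis
    by (metis mult_char_power)
qed

text \<open>
  The second orthogonality relation. It is what eliminates the two character sums in the
  definition of \<open>F4\<close>. Multiplying all characters by one that is not \<open>1\<close> at \<open>z\<close> permutes them
  and rescales the sum, which must therefore vanish.
\<close>

lemma sum_mult_chars:
  fixes z :: "'a::{field,finite}"
  shows "(\<Sum>\<nu>\<in>mult_chars. \<nu> z) = (if z = 1 then of_nat CARD('a) - 1 else 0)"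
proof (cases "z = 0 \<or> z = 1")
  case True
  moreover have "(\<Sum>\<nu>\<in>mult_chars. \<nu> (0::'a)) = 0"
    by (intro sum.neutral ballI mult_char_0)
  moreover have "(\<Sum>\<nu>\<in>mult_chars. \<nu> (1::'a)) = (\<Sum>\<nu>\<in>(mult_chars :: ('a \<Rightarrow> qbar) set). 1)"
    by (intro sum.cong refl mult_char_1)
  ultimately show ?thesis by (auto simp: card_mult_chars of_nat_diff)
next
  case False
  then obtain \<chi> :: "'a \<Rightarrow> qbar" where \<chi>: "\<chi> \<in> mult_chars" "\<chi> z \<noteq> 1"
    using mult_chars_separate_points by blast
  have canc: "inverse \<chi> * (\<chi> * \<nu>) = \<nu>" "\<chi> * (inverse \<chi> * \<nu>) = \<nu>" if "\<nu> \<in> mult_chars" for \<nu>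
  proof -
    have "inverse (\<chi> x) * (\<chi> x * \<nu> x) = \<nu> x" "\<chi> x * (inverse (\<chi> x) * \<nu> x) = \<nu> x" for x
      using that \<chi> mult_char_nonzero[OF \<chi>(1), of x] mult_char_0[of \<nu>] by (cases "x = 0"; simp)+
    thus "inverse \<chi> * (\<chi> * \<nu>) = \<nu>" "\<chi> * (inverse \<chi> * \<nu>) = \<nu>" by (auto simp: fun_eq_iff)
  qed
  have "(\<Sum>\<nu>\<in>mult_chars. \<nu> z) = (\<Sum>\<nu>\<in>mult_chars. (\<chi> * \<nu>) z)"
    by (rule sum.reindex_bij_witness[of _ "\<lambda>\<nu>. \<chi> * \<nu>" "\<lambda>\<nu>. inverse \<chi> * \<nu>"])
       (use \<chi>(1) canc in auto)
  also have "\<dots> = \<chi> z * (\<Sum>\<nu>\<in>mult_chars. \<nu> z)"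
    by (simp add: sum_distrib_left)
  finally show ?thesis using False \<chi> by simp
qed

section \<open>Gauss and Jacobi sums\<close>

lemma sum_units_scale:
  fixes f :: "'a::{field,finite} \<Rightarrow> 'b::comm_monoid_add"
  assumes "a \<noteq> 0"
  shows "(\<Sum>x\<in>UNIV - {0}. f (a * x)) = (\<Sum>x\<in>UNIV - {0}. f x)"
  by (rule sum.reindex_bij_witness[of _ "\<lambda>x. x / a" "\<lambda>x. a * x"]) (use assms in auto)

lemma sum_additive_char:
  fixes \<psi> :: "'a::{field,finite} \<Rightarrow> qbar"
  assumes "nontriv_additive_char \<psi>"
  shows "(\<Sum>x\<in>UNIV - {0}. \<psi> (a * x)) = (if a = 0 then of_nat CARD('a) else 0) - 1"
proof -
  have add: "\<psi> (x + y) = \<psi> x * \<psi> y" for x y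
    using assms by (simp add: nontriv_additive_char_def additive_char_def)
  have nz: "\<psi> 0 \<noteq> 0"
    using assms by (simp add: nontriv_additive_char_def additive_char_def)
  have psi0: "\<psi> 0 = 1" using add[of 0 0] nz by simp
  obtain z where z: "\<psi> z \<noteq> 1"
    using assms by (auto simp: nontriv_additive_char_def)
  have "(\<Sum>x\<in>UNIV. \<psi> (a * x)) = 0" if "a \<noteq> 0"
  proof -
    have "(\<Sum>x\<in>UNIV. \<psi> (a * x)) = (\<Sum>x\<in>UNIV. \<psi> (z + a * x))"
      by (rule sum.reindex_bij_witness[of _ "\<lambda>x. x + z / a" "\<lambda>x. x - z / a"])
         (use that in \<open>auto simp: algebra_simps\<close>)
    also have "\<dots> = \<psi> z * (\<Sum>x\<in>UNIV. \<psi> (a * x))"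
      by (simp add: add sum_distrib_left)
    finally show ?thesis using z by simp
  qed
  moreover have "(\<Sum>x\<in>UNIV. \<psi> (0 * x)) = of_nat CARD('a)" by (simp add: psi0)
  ultimately have "(\<Sum>x\<in>UNIV. \<psi> (a * x)) = (if a = 0 then of_nat CARD('a) else 0)" by auto
  moreover have "(\<Sum>x\<in>UNIV. \<psi> (a * x)) = \<psi> (a * 0) + (\<Sum>x\<in>UNIV - {0}. \<psi> (a * x))"
    by (rule sum.remove) auto
  ultimately show ?thesis using psi0 by (auto simp: algebra_simps eq_neg_iff_add_eq_0)
qed

lemma gauss_triv_char:
  assumes "nontriv_additive_char \<psi>"
  shows "gauss \<psi> triv_char = 1"
  using sum_additive_char[OF assms, of 1] by (simp add: gauss_def triv_char_def)

text \<open>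
  At \<open>a = 0\<close> the left-hand side vanishes because \<open>\<eta>\<close> is non-trivial, and the right-hand side
  because \<open>inverse 0 = 0\<close>. Later \<open>a\<close> is a function of two variables, and thanks to this case its
  zeros need no separate treatment.
\<close>

lemma gauss_scale:
  fixes \<psi> \<eta> :: "'a::{field,finite} \<Rightarrow> qbar"
  assumes "\<eta> \<in> mult_chars" "\<eta> \<noteq> triv_char"
  shows "(\<Sum>x\<in>UNIV - {0}. \<psi> (x * a) * \<eta> x) = - gauss \<psi> \<eta> * inverse (\<eta> a)"
proof (cases "a = 0")
  case True
  have "(\<Sum>x\<in>UNIV - {0}. \<psi> 0 * \<eta> x) = 0"
    using sum_mult_char[OF assms] by (simp flip: sum_distrib_left)
  with True show ?thesis by (simp add: mult_char_0[OF assms(1)])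
next
  case False
  have "(\<Sum>x\<in>UNIV - {0}. \<psi> (x * a) * \<eta> x) = (\<Sum>x\<in>UNIV - {0}. \<psi> (a * x) * \<eta> ((a * x) / a))"
    using False by (simp add: mult.commute)
  also have "\<dots> = (\<Sum>x\<in>UNIV - {0}. \<psi> x * \<eta> (x / a))"
    by (rule sum_units_scale[OF False])
  also have "\<dots> = - gauss \<psi> \<eta> * inverse (\<eta> a)"
    unfolding gauss_def mult_char_divide[OF assms(1)]
    by (simp add: sum_distrib_right divide_inverse mult.assoc)
  finally show ?thesis .
qed

text \<open>
  Substituting \<open>y = x r\<close> in the double sum turns a product of Gauss sums into a sum over the
  ratio \<open>r\<close>; both the reflection formula and the relation with Jacobi sums are read off from it.
\<close>

lemma gauss_mult_gauss:
  fixes \<psi> \<eta> \<chi> :: "'a::{field,finite} \<Rightarrow> qbar"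
  assumes \<psi>: "nontriv_additive_char \<psi>" and \<eta>: "\<eta> \<in> mult_chars" and \<chi>: "\<chi> \<in> mult_chars"
  shows "gauss \<psi> \<eta> * gauss \<psi> \<chi> =
    (\<Sum>r\<in>UNIV - {0}. \<chi> r * (\<Sum>x\<in>UNIV - {0}. \<psi> (x * (1 + r)) * (\<eta> * \<chi>) x))"
proof -
  have add: "\<psi> (x + y) = \<psi> x * \<psi> y" for x y
    using \<psi> by (simp add: nontriv_additive_char_def additive_char_def)
  have "gauss \<psi> \<eta> * gauss \<psi> \<chi> =
      (\<Sum>x\<in>UNIV - {0}. \<psi> x * \<eta> x * (\<Sum>y\<in>UNIV - {0}. \<psi> y * \<chi> y))"
    by (simp add: gauss_def sum_distrib_right)
  also have "\<dots> = (\<Sum>x\<in>UNIV - {0}. \<psi> x * \<eta> x * (\<Sum>r\<in>UNIV - {0}. \<psi> (x * r) * \<chi> (x * r)))"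
    by (intro sum.cong refl, subst sum_units_scale) auto
  also have "\<dots> = (\<Sum>x\<in>UNIV - {0}. \<Sum>r\<in>UNIV - {0}. \<chi> r * (\<psi> (x * (1 + r)) * (\<eta> * \<chi>) x))"
    by (simp add: sum_distrib_left mult_char_mult[OF \<chi>] distrib_left add mult_ac)
  also have "\<dots> = (\<Sum>r\<in>UNIV - {0}. \<chi> r * (\<Sum>x\<in>UNIV - {0}. \<psi> (x * (1 + r)) * (\<eta> * \<chi>) x))"
    by (subst sum.swap) (simp add: sum_distrib_left)
  finally show ?thesis .
qed

text \<open>
  For \<open>\<chi> = inverse \<eta>\<close> the inner sum only involves \<open>\<psi>\<close>. It is \<open>q - 1\<close> at \<open>r = -1\<close> and \<open>-1\<close>
  elsewhere, and the constant \<open>-1\<close> contributes nothing since \<open>\<eta>\<close> is non-trivial.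
\<close>

lemma gauss_mult_gauss_inverse:
  fixes \<psi> \<eta> :: "'a::{field,finite} \<Rightarrow> qbar"
  assumes \<psi>: "nontriv_additive_char \<psi>" and \<eta>: "\<eta> \<in> mult_chars" "\<eta> \<noteq> triv_char"
  shows "gauss \<psi> (inverse \<eta>) * gauss \<psi> \<eta> = \<eta> (-1) * of_nat CARD('a)"
proof -
  have "gauss \<psi> (inverse \<eta>) * gauss \<psi> \<eta> =
     (\<Sum>r\<in>UNIV - {0}. \<eta> r * (\<Sum>x\<in>UNIV - {0}. \<psi> (x * (1 + r)) * triv_char x))"
    using gauss_mult_gauss[OF \<psi> mult_chars_inverse[OF \<eta>(1)] \<eta>(1)]
    by (simp only: inverse_times_self[OF \<eta>(1)])
  also have "\<dots> = (\<Sum>r\<in>UNIV - {0}. \<eta> r * ((if r = -1 then of_nat CARD('a) else 0) - 1))"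
  proof (intro sum.cong refl)
    fix r :: 'a
    have "(\<Sum>x\<in>UNIV - {0}. \<psi> (x * (1 + r)) * triv_char x) = (\<Sum>x\<in>UNIV - {0}. \<psi> ((1 + r) * x))"
      by (intro sum.cong refl) (simp add: triv_char_def mult.commute)
    also have "1 + r = 0 \<longleftrightarrow> r = - 1"
      by (metis add.commute add_eq_0_iff)
    ultimately show "\<eta> r * (\<Sum>x\<in>UNIV - {0}. \<psi> (x * (1 + r)) * triv_char x) =
       \<eta> r * ((if r = -1 then of_nat CARD('a) else 0) - 1)"
      by (simp add: sum_additive_char[OF \<psi>])
  qed
  also have "\<dots> = (\<Sum>r\<in>UNIV - {0}. if r = -1 then \<eta> r * of_nat CARD('a) else 0) - (\<Sum>r\<in>UNIV - {0}. \<eta> r)"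
    unfolding sum_subtractf[symmetric] by (intro sum.cong refl) (simp add: algebra_simps)
  also have "\<dots> = \<eta> (-1) * of_nat CARD('a)"
    by (simp add: sum_mult_char[OF \<eta>])
  finally show ?thesis .
qed

lemma inverse_triv_char [simp]: "inverse triv_char = triv_char"
  by (auto simp: triv_char_def fun_eq_iff)

lemma inverse_inverse_fun [simp]: "inverse (inverse f) = (f :: 'a \<Rightarrow> 'b::field)"
  by (simp add: fun_eq_iff)

text \<open>
  The factor \<open>q\<close> that \<open>gauss_circ\<close> inserts at the trivial character makes the reflection formula
  uniform in \<open>\<eta>\<close>. Hence reciprocals of \<open>gauss_circ\<close> are again Gauss sums.
\<close>

lemma gauss_mult_gauss_circ_inverse:
  fixes \<psi> \<eta> :: "'a::{field,finite} \<Rightarrow> qbar"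
  assumes \<psi>: "nontriv_additive_char \<psi>" and \<eta>: "\<eta> \<in> mult_chars"
  shows "gauss \<psi> (inverse \<eta>) * gauss_circ \<psi> \<eta> = \<eta> (-1) * of_nat CARD('a)"
proof (cases "\<eta> = triv_char")
  case True
  thus ?thesis by (simp add: gauss_triv_char[OF \<psi>] gauss_circ_def char_delta_def triv_char_def)
next
  case False
  thus ?thesis using gauss_mult_gauss_inverse[OF \<psi> \<eta>] by (simp add: gauss_circ_def char_delta_def)
qed

lemma inverse_gauss_circ:
  fixes \<psi> \<eta> :: "'a::{field,finite} \<Rightarrow> qbar"
  assumes \<psi>: "nontriv_additive_char \<psi>" and \<eta>: "\<eta> \<in> mult_chars"
  shows "inverse (gauss_circ \<psi> \<eta>) = \<eta> (-1) * gauss \<psi> (inverse \<eta>) / of_nat CARD('a)"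
proof -
  have "gauss_circ \<psi> \<eta> * (\<eta> (-1) * gauss \<psi> (inverse \<eta>) / of_nat CARD('a)) =
     \<eta> (-1) * (gauss \<psi> (inverse \<eta>) * gauss_circ \<psi> \<eta>) / of_nat CARD('a)" by simp
  also have "\<dots> = 1"
    unfolding gauss_mult_gauss_circ_inverse[OF assms]
    using mult_char_minus_1_square[OF \<eta>] by (simp add: mult.assoc[symmetric])
  finally show ?thesis by (rule inverse_unique)
qed

lemma gauss_nonzero:
  fixes \<psi> \<eta> :: "'a::{field,finite} \<Rightarrow> qbar"
  assumes \<psi>: "nontriv_additive_char \<psi>" and \<eta>: "\<eta> \<in> mult_chars"
  shows "gauss \<psi> \<eta> \<noteq> 0"
proof -
  have "\<eta> (-1) * of_nat CARD('a) \<noteq> 0"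
    using mult_char_nonzero[OF \<eta>, of "-1"] by simp
  with gauss_mult_gauss_circ_inverse[OF assms] show ?thesis by (auto simp: gauss_circ_def)
qed

lemma jacobi_eq_sum:
  fixes \<eta> \<chi> :: "'a::{field,finite} \<Rightarrow> qbar"
  assumes "\<chi> \<in> mult_chars"
  shows "jacobi \<eta> \<chi> = - (\<Sum>x\<in>UNIV - {0}. \<eta> x * \<chi> (1 - x))"
proof -
  have "(\<Sum>(x, y) \<in> {(x, y). x \<noteq> 0 \<and> y \<noteq> 0 \<and> x + y = 1}. \<eta> x * \<chi> y) =
        (\<Sum>x\<in>UNIV - {0} - {1}. \<eta> x * \<chi> (1 - x))"
    by (rule sum.reindex_bij_witness[of _ "\<lambda>x. (x, 1 - x)" fst]) (auto simp flip: eq_diff_eq)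
  also have "\<dots> = (\<Sum>x\<in>UNIV - {0}. \<eta> x * \<chi> (1 - x))"
    by (rule sum.mono_neutral_left) (auto simp: mult_char_0[OF assms])
  finally show ?thesis by (simp add: jacobi_def)
qed

lemma jacobi_commute: "jacobi \<eta> \<chi> = jacobi \<chi> \<eta>"
  unfolding jacobi_def
  by (intro arg_cong[where f = uminus] sum.reindex_bij_witness[of _ prod.swap prod.swap])
     (auto simp: mult.commute add.commute)

text \<open>
  The points of the line \<open>x + y = 1\<close> off the axes are parametrised by \<open>r = y / x\<close>, with
  \<open>x = 1 / (1 + r)\<close>; the missing value \<open>r = -1\<close> contributes \<open>0\<close> because characters vanish at \<open>0\<close>.
\<close>

lemma jacobi_eq_sum_ratio:
  fixes \<eta> \<chi> :: "'a::{field,finite} \<Rightarrow> qbar"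
  assumes \<eta>: "\<eta> \<in> mult_chars" and \<chi>: "\<chi> \<in> mult_chars"
  shows "jacobi \<eta> \<chi> = - (\<Sum>r\<in>UNIV - {0}. \<chi> r * inverse ((\<eta> * \<chi>) (1 + r)))"
proof -
  have "(\<Sum>(x, y) \<in> {(x, y). x \<noteq> 0 \<and> y \<noteq> 0 \<and> x + y = 1}. \<eta> x * \<chi> y) =
        (\<Sum>r\<in>UNIV - {0} - {-1}. \<chi> r * inverse ((\<eta> * \<chi>) (1 + r)))"
  proof (rule sum.reindex_bij_witness[of _ "\<lambda>r. (1 / (1 + r), r / (1 + r))" "\<lambda>(x, y). y / x"])
    fix p assume p: "p \<in> {(x :: 'a, y). x \<noteq> 0 \<and> y \<noteq> 0 \<and> x + y = 1}"
    then obtain x y where xy: "p = (x, y)" "x \<noteq> 0" "y \<noteq> 0" "x + y = 1" by auto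
    have 1: "1 + y / x = 1 / x" using xy by (simp add: field_simps)
    show "(1 / (1 + (case p of (x, y) \<Rightarrow> y / x)), (case p of (x, y) \<Rightarrow> y / x) / (1 + (case p of (x, y) \<Rightarrow> y / x))) = p"
      using xy by (simp add: 1)
    show "(case p of (x, y) \<Rightarrow> y / x) \<in> UNIV - {0} - {- 1}"
      using xy 1 by (auto simp: field_simps)
    show "\<chi> (case p of (x, y) \<Rightarrow> y / x) * inverse ((\<eta> * \<chi>) (1 + (case p of (x, y) \<Rightarrow> y / x))) =
        (case p of (x, y) \<Rightarrow> \<eta> x * \<chi> y)"
      using xy(2) mult_char_nonzero[OF \<eta>, of x] mult_char_nonzero[OF \<chi>, of x]
      by (simp add: xy(1) 1 mult_char_divide[OF \<eta>] mult_char_divide[OF \<chi>] mult_char_1[OF \<eta>] mult_char_1[OF \<chi>])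
  next
    fix r :: 'a assume "r \<in> UNIV - {0} - {-1}"
    hence r: "r \<noteq> 0" "1 + r \<noteq> 0" by (auto simp: add_eq_0_iff)
    show "(case (1 / (1 + r), r / (1 + r)) of (x, y) \<Rightarrow> y / x) = r"
      using r by simp
    show "(1 / (1 + r), r / (1 + r)) \<in> {(x, y). x \<noteq> 0 \<and> y \<noteq> 0 \<and> x + y = 1}"
      using r by (simp add: add_divide_distrib[symmetric])
  qed
  also have "\<dots> = (\<Sum>r\<in>UNIV - {0}. \<chi> r * inverse ((\<eta> * \<chi>) (1 + r)))"
    by (rule sum.mono_neutral_left) (auto simp: mult_char_0[OF \<chi>])
  finally show ?thesis by (simp add: jacobi_def)
qed

text \<open>
  If the product character is non-trivial, \<open>gauss_scale\<close> evaluates the inner sums of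
  \<open>gauss_mult_gauss\<close>, and what remains is the ratio form of the Jacobi sum. If it is trivial,
  \<open>jacobi\<close> equals \<open>\<chi> (-1)\<close> by orthogonality and the claim is the reflection formula.
\<close>

lemma jacobi_mult_gauss_circ:
  fixes \<psi> \<eta> \<chi> :: "'a::{field,finite} \<Rightarrow> qbar"
  assumes \<psi>: "nontriv_additive_char \<psi>" and \<eta>: "\<eta> \<in> mult_chars" "\<eta> \<noteq> triv_char" and \<chi>: "\<chi> \<in> mult_chars"
  shows "jacobi \<eta> \<chi> * gauss_circ \<psi> (\<eta> * \<chi>) = gauss \<psi> \<eta> * gauss \<psi> \<chi>"
proof (cases "\<eta> * \<chi> = triv_char")
  case False
  have "gauss \<psi> \<eta> * gauss \<psi> \<chi> = (\<Sum>r\<in>UNIV - {0}. \<chi> r * (- gauss \<psi> (\<eta> * \<chi>) * inverse ((\<eta> * \<chi>) (1 + r))))"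
    unfolding gauss_mult_gauss[OF \<psi> \<eta>(1) \<chi>]
    by (subst gauss_scale[OF mult_chars_times[OF \<eta>(1) \<chi>] False]) (rule refl)
  also have "\<dots> = jacobi \<eta> \<chi> * gauss \<psi> (\<eta> * \<chi>)"
    by (simp add: jacobi_eq_sum_ratio[OF \<eta>(1) \<chi>] sum_distrib_left sum_negf mult_ac)
  finally show ?thesis using False by (simp add: gauss_circ_def char_delta_def)
next
  case True
  hence \<eta>_eq: "\<eta> = inverse \<chi>"
    using inverse_times_eq_triv_char_iff[of "inverse \<eta>" \<chi>] \<eta> \<chi> by simp
  hence \<chi>': "\<chi> \<noteq> triv_char" using \<eta>(2) by auto
  have "(\<Sum>r\<in>UNIV - {0}. \<chi> r * inverse ((\<eta> * \<chi>) (1 + r))) = (\<Sum>r\<in>UNIV - {0} - {-1}. \<chi> r)"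
    unfolding True
    by (rule sum.mono_neutral_cong_right) (auto simp: triv_char_def add_eq_0_iff)
  also have "\<dots> = - \<chi> (-1)"
    using sum_mult_char[OF \<chi> \<chi>'] sum.remove[of "UNIV - {0}" "-1" \<chi>] by (simp add: add_eq_0_iff)
  finally have "jacobi \<eta> \<chi> = \<chi> (-1)"
    by (simp add: jacobi_eq_sum_ratio[OF \<eta>(1) \<chi>])
  thus ?thesis unfolding True
    using gauss_mult_gauss_inverse[OF \<psi> \<chi> \<chi>']
    by (simp add: \<eta>_eq gauss_circ_def char_delta_def gauss_triv_char[OF \<psi>])
qed

section \<open>From the character sums of F4 to an exponential sum\<close>

lemma sum_swap2:
  "(\<Sum>a\<in>A. \<Sum>b\<in>B. \<Sum>c\<in>C. \<Sum>d\<in>D. f a b c d) = (\<Sum>c\<in>C. \<Sum>d\<in>D. \<Sum>a\<in>A. \<Sum>b\<in>B. f a b c d)"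
proof -
  have "(\<Sum>a\<in>A. \<Sum>b\<in>B. \<Sum>c\<in>C. \<Sum>d\<in>D. f a b c d) = (\<Sum>a\<in>A. \<Sum>c\<in>C. \<Sum>b\<in>B. \<Sum>d\<in>D. f a b c d)"
    by (intro sum.cong refl sum.swap)
  also have "\<dots> = (\<Sum>c\<in>C. \<Sum>a\<in>A. \<Sum>b\<in>B. \<Sum>d\<in>D. f a b c d)"
    by (rule sum.swap)
  also have "\<dots> = (\<Sum>c\<in>C. \<Sum>a\<in>A. \<Sum>d\<in>D. \<Sum>b\<in>B. f a b c d)"
    by (intro sum.cong refl sum.swap)
  also have "\<dots> = (\<Sum>c\<in>C. \<Sum>d\<in>D. \<Sum>a\<in>A. \<Sum>b\<in>B. f a b c d)"
    by (intro sum.cong refl sum.swap)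
  finally show ?thesis .
qed

text \<open>
  The finite-field analogue of a Bessel function: its Mellin transform is a product of two Gauss
  sums, as that of a Bessel function is a product of Gamma factors.
\<close>

definition kloosterman ::
  "('a::{field,finite} \<Rightarrow> qbar) \<Rightarrow> ('a \<Rightarrow> qbar) \<Rightarrow> 'a \<Rightarrow> qbar" where
  "kloosterman \<psi> \<gamma> w = (\<Sum>c\<in>UNIV - {0}. \<psi> (c + w / c) * inverse (\<gamma> c))"

text \<open>
  The part of the summand of \<open>F4\<close> that depends on one character \<open>\<nu>\<close> alone is a product of two
  Gauss sums. Writing both out as sums over \<open>c\<close> and \<open>d\<close>, the sum over \<open>\<nu>\<close> selects \<open>c d = w\<close>.
\<close>

lemma kloosterman_mellin:
  fixes \<psi> \<gamma> :: "'a::{field,finite} \<Rightarrow> qbar"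
  assumes \<psi>: "nontriv_additive_char \<psi>" and w: "w \<noteq> 0"
  shows "(\<Sum>\<nu>\<in>mult_chars. gauss \<psi> (inverse (\<gamma> * \<nu>)) * gauss \<psi> (inverse \<nu>) * \<nu> w) =
    (of_nat CARD('a) - 1) * kloosterman \<psi> \<gamma> w"
proof -
  let ?U = "UNIV - {0::'a}"
  have add: "\<psi> (a + b) = \<psi> a * \<psi> b" for a b
    using \<psi> by (simp add: nontriv_additive_char_def additive_char_def)
  have "(\<Sum>\<nu>\<in>mult_chars. gauss \<psi> (inverse (\<gamma> * \<nu>)) * gauss \<psi> (inverse \<nu>) * \<nu> w) =
     (\<Sum>\<nu>\<in>mult_chars. \<Sum>c\<in>?U. \<Sum>d\<in>?U. \<psi> (c + d) * inverse (\<gamma> c) * \<nu> (w / (c * d)))"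
  proof (intro sum.cong refl)
    fix \<nu> :: "'a \<Rightarrow> qbar" assume \<nu>: "\<nu> \<in> mult_chars"
    show "gauss \<psi> (inverse (\<gamma> * \<nu>)) * gauss \<psi> (inverse \<nu>) * \<nu> w =
       (\<Sum>c\<in>?U. \<Sum>d\<in>?U. \<psi> (c + d) * inverse (\<gamma> c) * \<nu> (w / (c * d)))"
      unfolding mult_char_divide[OF \<nu>] mult_char_mult[OF \<nu>] add gauss_def
      by (simp add: sum_product sum_distrib_left sum_distrib_right sum_negf divide_inverse mult_ac)
  qed
  also have "\<dots> = (\<Sum>c\<in>?U. \<Sum>\<nu>\<in>mult_chars. \<Sum>d\<in>?U. \<psi> (c + d) * inverse (\<gamma> c) * \<nu> (w / (c * d)))"
    by (rule sum.swap)
  also have "\<dots> = (\<Sum>c\<in>?U. \<Sum>d\<in>?U. \<Sum>\<nu>\<in>mult_chars. \<psi> (c + d) * inverse (\<gamma> c) * \<nu> (w / (c * d)))"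
    by (intro sum.cong refl sum.swap)
  also have "\<dots> = (\<Sum>c\<in>?U. (of_nat CARD('a) - 1) * (\<psi> (c + w / c) * inverse (\<gamma> c)))"
  proof (intro sum.cong refl)
    fix c :: 'a assume c: "c \<in> ?U"
    have "(\<Sum>d\<in>?U. \<Sum>\<nu>\<in>mult_chars. \<psi> (c + d) * inverse (\<gamma> c) * \<nu> (w / (c * d))) =
        (\<Sum>d\<in>?U. if d = w / c then \<psi> (c + d) * inverse (\<gamma> c) * (of_nat CARD('a) - 1) else 0)"
    proof (intro sum.cong refl)
      fix d :: 'a assume d: "d \<in> ?U"
      have "w / (c * d) = 1 \<longleftrightarrow> d = w / c" using c d by (auto simp: field_simps)
      thus "(\<Sum>\<nu>\<in>mult_chars. \<psi> (c + d) * inverse (\<gamma> c) * \<nu> (w / (c * d))) =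
          (if d = w / c then \<psi> (c + d) * inverse (\<gamma> c) * (of_nat CARD('a) - 1) else 0)"
        unfolding sum_distrib_left[symmetric] sum_mult_chars by simp
    qed
    also have "\<dots> = (of_nat CARD('a) - 1) * (\<psi> (c + w / c) * inverse (\<gamma> c))"
      using c w by simp
    finally show "(\<Sum>d\<in>?U. \<Sum>\<nu>\<in>mult_chars. \<psi> (c + d) * inverse (\<gamma> c) * \<nu> (w / (c * d))) =
        (of_nat CARD('a) - 1) * (\<psi> (c + w / c) * inverse (\<gamma> c))" .
  qed
  finally show ?thesis by (simp add: kloosterman_def sum_distrib_left)
qed

text \<open>
  Reflection turns the denominators into Gauss sums. The two signs \<open>\<nu> (-1)\<close> that arise, one from
  each factor, cancel.
\<close>

lemma inverse_poch_circ_mult: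
  fixes \<psi> \<gamma> \<nu> :: "'a::{field,finite} \<Rightarrow> qbar"
  assumes \<psi>: "nontriv_additive_char \<psi>" and \<gamma>: "\<gamma> \<in> mult_chars" and \<nu>: "\<nu> \<in> mult_chars"
  shows "inverse (poch_circ \<psi> \<gamma> \<nu> * poch_circ \<psi> triv_char \<nu>) =
    gauss_circ \<psi> \<gamma> * \<gamma> (-1) / of_nat CARD('a) *
    (gauss \<psi> (inverse (\<gamma> * \<nu>)) * gauss \<psi> (inverse \<nu>))"
proof -
  have triv: "gauss_circ \<psi> triv_char = of_nat CARD('a)"
    by (simp add: gauss_circ_def char_delta_def gauss_triv_char[OF \<psi>])
  have "inverse (poch_circ \<psi> \<gamma> \<nu> * poch_circ \<psi> triv_char \<nu>) =
    gauss_circ \<psi> \<gamma> * of_nat CARD('a) * inverse (gauss_circ \<psi> (\<gamma> * \<nu>)) * inverse (gauss_circ \<psi> \<nu>)"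
    by (simp add: poch_circ_def triv triv_char_times[OF \<nu>] divide_inverse)
  also have "\<dots> = (\<nu> (-1) * \<nu> (-1)) * (gauss_circ \<psi> \<gamma> * \<gamma> (-1) / of_nat CARD('a) *
    (gauss \<psi> (inverse (\<gamma> * \<nu>)) * gauss \<psi> (inverse \<nu>)))"
    unfolding inverse_gauss_circ[OF \<psi> \<nu>] inverse_gauss_circ[OF \<psi> mult_chars_times[OF \<gamma> \<nu>]]
    by simp
  finally show ?thesis by (simp add: mult_char_minus_1_square[OF \<nu>])
qed

lemma card_minus_1_nonzero: "of_nat CARD('a::{field,finite}) - (1 :: qbar) \<noteq> 0"
proof -
  have "card {0, 1 :: 'a} \<le> CARD('a)" by (rule card_mono) auto
  hence "CARD('a) \<noteq> 1" by simp
  thus ?thesis by (metis eq_iff_diff_eq_0 of_nat_1 of_nat_eq_iff)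
qed

text \<open>
  Once the denominators are Gauss sums, the numerators \<open>gauss \<psi> (\<alpha> * \<nu>\<^sub>1 * \<nu>\<^sub>2)\<close> and
  \<open>gauss \<psi> (\<beta> * \<nu>\<^sub>1 * \<nu>\<^sub>2)\<close> are written as sums over \<open>s\<close> and \<open>t\<close>. The characters \<open>\<nu>\<^sub>1\<close> and \<open>\<nu>\<^sub>2\<close> then
  occur in separate factors, and each of the two sums over them is a Mellin transform of a
  Kloosterman sum. The factors \<open>q - 1\<close> cancel the normalisation \<open>1 / (1 - q)\<^sup>2\<close>.
\<close>

lemma F4_eq_kloosterman_sum:
  fixes \<psi> \<alpha> \<beta> \<gamma>\<^sub>1 \<gamma>\<^sub>2 :: "'a::{field,finite} \<Rightarrow> qbar"
  assumes \<psi>: "nontriv_additive_char \<psi>"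
    and \<gamma>: "\<gamma>\<^sub>1 \<in> mult_chars" "\<gamma>\<^sub>2 \<in> mult_chars" and z: "z\<^sub>1 \<noteq> 0" "z\<^sub>2 \<noteq> 0"
  shows "F4 \<psi> \<alpha> \<beta> \<gamma>\<^sub>1 \<gamma>\<^sub>2 z\<^sub>1 z\<^sub>2 =
    gauss_circ \<psi> \<gamma>\<^sub>1 * gauss_circ \<psi> \<gamma>\<^sub>2 * \<gamma>\<^sub>1 (-1) * \<gamma>\<^sub>2 (-1) /
      (gauss \<psi> \<alpha> * gauss \<psi> \<beta> * of_nat CARD('a) ^ 2) *
    (\<Sum>s\<in>UNIV - {0}. \<Sum>t\<in>UNIV - {0}. \<psi> (s + t) * \<alpha> s * \<beta> t *
       kloosterman \<psi> \<gamma>\<^sub>1 (s * t * z\<^sub>1) * kloosterman \<psi> \<gamma>\<^sub>2 (s * t * z\<^sub>2))"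
proof -
  let ?U = "UNIV - {0::'a}" and ?q = "of_nat CARD('a) :: qbar"
  have add: "\<psi> (a + b) = \<psi> a * \<psi> b" for a b
    using \<psi> by (simp add: nontriv_additive_char_def additive_char_def)
  define C where "C = gauss_circ \<psi> \<gamma>\<^sub>1 * gauss_circ \<psi> \<gamma>\<^sub>2 * \<gamma>\<^sub>1 (-1) * \<gamma>\<^sub>2 (-1) /
      (gauss \<psi> \<alpha> * gauss \<psi> \<beta> * ?q ^ 2)"
  define M where "M = (\<lambda>\<gamma> (\<nu> :: 'a \<Rightarrow> qbar). gauss \<psi> (inverse (\<gamma> * \<nu>)) * gauss \<psi> (inverse \<nu>))"
  have "(\<Sum>\<nu>\<^sub>1\<in>mult_chars. \<Sum>\<nu>\<^sub>2\<in>mult_chars.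
        (poch \<psi> \<alpha> (\<nu>\<^sub>1 * \<nu>\<^sub>2) * poch \<psi> \<beta> (\<nu>\<^sub>1 * \<nu>\<^sub>2)) /
        (poch_circ \<psi> \<gamma>\<^sub>1 \<nu>\<^sub>1 * poch_circ \<psi> \<gamma>\<^sub>2 \<nu>\<^sub>2 *
         poch_circ \<psi> triv_char \<nu>\<^sub>1 * poch_circ \<psi> triv_char \<nu>\<^sub>2) *
        \<nu>\<^sub>1 z\<^sub>1 * \<nu>\<^sub>2 z\<^sub>2) =
     (\<Sum>\<nu>\<^sub>1\<in>mult_chars. \<Sum>\<nu>\<^sub>2\<in>mult_chars. \<Sum>s\<in>?U. \<Sum>t\<in>?U.
        C * (\<psi> (s + t) * \<alpha> s * \<beta> t) *
        ((M \<gamma>\<^sub>1 \<nu>\<^sub>1 * \<nu>\<^sub>1 (s * t * z\<^sub>1)) * (M \<gamma>\<^sub>2 \<nu>\<^sub>2 * \<nu>\<^sub>2 (s * t * z\<^sub>2))))"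
  proof (intro sum.cong refl)
    fix \<nu>\<^sub>1 \<nu>\<^sub>2 :: "'a \<Rightarrow> qbar" assume \<nu>: "\<nu>\<^sub>1 \<in> mult_chars" "\<nu>\<^sub>2 \<in> mult_chars"
    have "(poch \<psi> \<alpha> (\<nu>\<^sub>1 * \<nu>\<^sub>2) * poch \<psi> \<beta> (\<nu>\<^sub>1 * \<nu>\<^sub>2)) /
        (poch_circ \<psi> \<gamma>\<^sub>1 \<nu>\<^sub>1 * poch_circ \<psi> \<gamma>\<^sub>2 \<nu>\<^sub>2 *
         poch_circ \<psi> triv_char \<nu>\<^sub>1 * poch_circ \<psi> triv_char \<nu>\<^sub>2) *
        \<nu>\<^sub>1 z\<^sub>1 * \<nu>\<^sub>2 z\<^sub>2 =
        (poch \<psi> \<alpha> (\<nu>\<^sub>1 * \<nu>\<^sub>2) * poch \<psi> \<beta> (\<nu>\<^sub>1 * \<nu>\<^sub>2)) *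
        (inverse (poch_circ \<psi> \<gamma>\<^sub>1 \<nu>\<^sub>1 * poch_circ \<psi> triv_char \<nu>\<^sub>1) *
         inverse (poch_circ \<psi> \<gamma>\<^sub>2 \<nu>\<^sub>2 * poch_circ \<psi> triv_char \<nu>\<^sub>2)) *
        \<nu>\<^sub>1 z\<^sub>1 * \<nu>\<^sub>2 z\<^sub>2"
      by (simp add: divide_inverse mult_ac)
    also have "\<dots> = C * (gauss \<psi> (\<alpha> * (\<nu>\<^sub>1 * \<nu>\<^sub>2)) * gauss \<psi> (\<beta> * (\<nu>\<^sub>1 * \<nu>\<^sub>2))) *
        (M \<gamma>\<^sub>1 \<nu>\<^sub>1 * \<nu>\<^sub>1 z\<^sub>1) * (M \<gamma>\<^sub>2 \<nu>\<^sub>2 * \<nu>\<^sub>2 z\<^sub>2)"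
      unfolding inverse_poch_circ_mult[OF \<psi> \<gamma>(1) \<nu>(1)] inverse_poch_circ_mult[OF \<psi> \<gamma>(2) \<nu>(2)]
      by (simp add: poch_def C_def M_def power2_eq_square divide_inverse mult_ac)
    also have "gauss \<psi> (\<alpha> * (\<nu>\<^sub>1 * \<nu>\<^sub>2)) * gauss \<psi> (\<beta> * (\<nu>\<^sub>1 * \<nu>\<^sub>2)) =
        (\<Sum>s\<in>?U. \<Sum>t\<in>?U. \<psi> (s + t) * \<alpha> s * \<beta> t * (\<nu>\<^sub>1 (s * t) * \<nu>\<^sub>2 (s * t)))"
      unfolding gauss_def mult_char_mult[OF \<nu>(1)] mult_char_mult[OF \<nu>(2)] add
      by (simp add: sum_product mult_ac)
    also have "C * \<dots> * (M \<gamma>\<^sub>1 \<nu>\<^sub>1 * \<nu>\<^sub>1 z\<^sub>1) * (M \<gamma>\<^sub>2 \<nu>\<^sub>2 * \<nu>\<^sub>2 z\<^sub>2) = (\<Sum>s\<in>?U. \<Sum>t\<in>?U.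
        C * (\<psi> (s + t) * \<alpha> s * \<beta> t) *
        ((M \<gamma>\<^sub>1 \<nu>\<^sub>1 * \<nu>\<^sub>1 (s * t * z\<^sub>1)) * (M \<gamma>\<^sub>2 \<nu>\<^sub>2 * \<nu>\<^sub>2 (s * t * z\<^sub>2))))"
      unfolding mult_char_mult[OF \<nu>(1), of _ z\<^sub>1] mult_char_mult[OF \<nu>(2), of _ z\<^sub>2]
      by (simp add: sum_distrib_left sum_distrib_right mult_ac)
    finally show "(poch \<psi> \<alpha> (\<nu>\<^sub>1 * \<nu>\<^sub>2) * poch \<psi> \<beta> (\<nu>\<^sub>1 * \<nu>\<^sub>2)) /
        (poch_circ \<psi> \<gamma>\<^sub>1 \<nu>\<^sub>1 * poch_circ \<psi> \<gamma>\<^sub>2 \<nu>\<^sub>2 *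
         poch_circ \<psi> triv_char \<nu>\<^sub>1 * poch_circ \<psi> triv_char \<nu>\<^sub>2) *
        \<nu>\<^sub>1 z\<^sub>1 * \<nu>\<^sub>2 z\<^sub>2 = (\<Sum>s\<in>?U. \<Sum>t\<in>?U.
        C * (\<psi> (s + t) * \<alpha> s * \<beta> t) *
        ((M \<gamma>\<^sub>1 \<nu>\<^sub>1 * \<nu>\<^sub>1 (s * t * z\<^sub>1)) * (M \<gamma>\<^sub>2 \<nu>\<^sub>2 * \<nu>\<^sub>2 (s * t * z\<^sub>2))))" .
  qed
  also have "\<dots> = (\<Sum>s\<in>?U. \<Sum>t\<in>?U. \<Sum>\<nu>\<^sub>1\<in>mult_chars. \<Sum>\<nu>\<^sub>2\<in>mult_chars.
        C * (\<psi> (s + t) * \<alpha> s * \<beta> t) *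
        ((M \<gamma>\<^sub>1 \<nu>\<^sub>1 * \<nu>\<^sub>1 (s * t * z\<^sub>1)) * (M \<gamma>\<^sub>2 \<nu>\<^sub>2 * \<nu>\<^sub>2 (s * t * z\<^sub>2))))"
    by (rule sum_swap2)
  also have "\<dots> = (\<Sum>s\<in>?U. \<Sum>t\<in>?U. C * (\<psi> (s + t) * \<alpha> s * \<beta> t) *
        (((?q - 1) * kloosterman \<psi> \<gamma>\<^sub>1 (s * t * z\<^sub>1)) * ((?q - 1) * kloosterman \<psi> \<gamma>\<^sub>2 (s * t * z\<^sub>2))))"
  proof (intro sum.cong refl)
    fix s t assume st: "s \<in> ?U" "t \<in> ?U"
    have "(\<Sum>\<nu>\<in>mult_chars. M \<gamma>\<^sub>1 \<nu> * \<nu> (s * t * z\<^sub>1)) = (?q - 1) * kloosterman \<psi> \<gamma>\<^sub>1 (s * t * z\<^sub>1)"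
         "(\<Sum>\<nu>\<in>mult_chars. M \<gamma>\<^sub>2 \<nu> * \<nu> (s * t * z\<^sub>2)) = (?q - 1) * kloosterman \<psi> \<gamma>\<^sub>2 (s * t * z\<^sub>2)"
      unfolding M_def using st z by (simp_all add: kloosterman_mellin[OF \<psi>])
    thus "(\<Sum>\<nu>\<^sub>1\<in>mult_chars. \<Sum>\<nu>\<^sub>2\<in>mult_chars.
        C * (\<psi> (s + t) * \<alpha> s * \<beta> t) *
        ((M \<gamma>\<^sub>1 \<nu>\<^sub>1 * \<nu>\<^sub>1 (s * t * z\<^sub>1)) * (M \<gamma>\<^sub>2 \<nu>\<^sub>2 * \<nu>\<^sub>2 (s * t * z\<^sub>2)))) =
        C * (\<psi> (s + t) * \<alpha> s * \<beta> t) *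
        (((?q - 1) * kloosterman \<psi> \<gamma>\<^sub>1 (s * t * z\<^sub>1)) * ((?q - 1) * kloosterman \<psi> \<gamma>\<^sub>2 (s * t * z\<^sub>2)))"
      by (simp only: sum_distrib_left[symmetric] sum_distrib_right[symmetric])
  qed
  also have "\<dots> = (?q - 1) ^ 2 * (C * (\<Sum>s\<in>?U. \<Sum>t\<in>?U. \<psi> (s + t) * \<alpha> s * \<beta> t *
        kloosterman \<psi> \<gamma>\<^sub>1 (s * t * z\<^sub>1) * kloosterman \<psi> \<gamma>\<^sub>2 (s * t * z\<^sub>2)))"
    by (simp add: sum_distrib_left power2_eq_square mult_ac)
  finally show ?thesis
    unfolding F4_def C_def power2_commute[of 1 ?q]
    using card_minus_1_nonzero[where 'a = 'a] by simp
qed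

section \<open>Linearising the exponent\<close>

text \<open>
  The summand that is left when the additive character has been summed out. The arguments of the
  last two characters are the coefficients of \<open>c\<close> and \<open>d\<close> in the exponent after the substitution
  \<open>s = c S / x\<close>, \<open>t = d T / y\<close>.
\<close>

definition reduced_term ::
  "('a::{field,finite} \<Rightarrow> qbar) \<Rightarrow> ('a \<Rightarrow> qbar) \<Rightarrow> ('a \<Rightarrow> qbar) \<Rightarrow> ('a \<Rightarrow> qbar) \<Rightarrow> 'a \<Rightarrow> 'a \<Rightarrow> 'a \<Rightarrow> 'a \<Rightarrow> qbar" where
  "reduced_term \<alpha> \<beta> \<gamma>\<^sub>1 \<gamma>\<^sub>2 x y S T = \<alpha> S * \<beta> T *
     (inverse \<alpha> * \<gamma>\<^sub>1) (1 - S * T + S * (1 + T) / x) *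
     (inverse \<beta> * \<gamma>\<^sub>2) (1 - S * T + T * (1 + S) / y)"

text \<open>
  This is where the special arguments \<open>x (1 - y)\<close> and \<open>y (1 - x)\<close> matter. With the Kloosterman sums
  written out over \<open>c\<close> and \<open>d\<close>, the exponent is
  \<open>s + t + c + d + s t x (1 - y) / c + s t y (1 - x) / d\<close>. Substituting \<open>s = c S / x\<close> and
  \<open>t = d T / y\<close> makes it linear in \<open>c\<close> and \<open>d\<close>,
  namely \<open>c (1 - S T + S (1 + T) / x) + d (1 - S T + T (1 + S) / y)\<close>. The sums over \<open>c\<close> and \<open>d\<close> are
  then Gauss sums for the characters \<open>inverse \<gamma>\<^sub>1 * \<alpha>\<close> and \<open>inverse \<gamma>\<^sub>2 * \<beta>\<close>, which are non-trivial.
\<close>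

lemma kloosterman_sum_eq_reduced_sum:
  fixes \<psi> \<alpha> \<beta> \<gamma>\<^sub>1 \<gamma>\<^sub>2 :: "'a::{field,finite} \<Rightarrow> qbar"
  assumes \<psi>: "nontriv_additive_char \<psi>"
    and \<alpha>: "\<alpha> \<in> mult_chars" and \<beta>: "\<beta> \<in> mult_chars"
    and \<gamma>: "\<gamma>\<^sub>1 \<in> mult_chars" "\<gamma>\<^sub>2 \<in> mult_chars"
    and ne: "\<alpha> \<noteq> \<gamma>\<^sub>1" "\<beta> \<noteq> \<gamma>\<^sub>2" and xy: "x \<noteq> 0" "y \<noteq> 0"
  shows "(\<Sum>s\<in>UNIV - {0}. \<Sum>t\<in>UNIV - {0}. \<psi> (s + t) * \<alpha> s * \<beta> t *
       kloosterman \<psi> \<gamma>\<^sub>1 (s * t * (x * (1 - y))) * kloosterman \<psi> \<gamma>\<^sub>2 (s * t * (y * (1 - x)))) =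
    gauss \<psi> (inverse \<gamma>\<^sub>1 * \<alpha>) * gauss \<psi> (inverse \<gamma>\<^sub>2 * \<beta>) * inverse (\<alpha> x) * inverse (\<beta> y) *
    (\<Sum>S\<in>UNIV - {0}. \<Sum>T\<in>UNIV - {0}. reduced_term \<alpha> \<beta> \<gamma>\<^sub>1 \<gamma>\<^sub>2 x y S T)"
proof -
  let ?U = "UNIV - {0::'a}"
  have add: "\<psi> (a + b) = \<psi> a * \<psi> b" for a b
    using \<psi> by (simp add: nontriv_additive_char_def additive_char_def)
  define A where "A S T = 1 - S * T + S * (1 + T) / x" for S T
  define B where "B S T = 1 - S * T + T * (1 + S) / y" for S T
  define f where "f s t c d = \<alpha> s * \<beta> t * inverse (\<gamma>\<^sub>1 c) * inverse (\<gamma>\<^sub>2 d) *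
     \<psi> (s + t + (c + s * t * (x * (1 - y)) / c) + (d + s * t * (y * (1 - x)) / d))" for s t c d
  define k where "k = inverse (\<alpha> x) * inverse (\<beta> y)"
  \<comment> \<open>The substitution \<open>s = c S / x\<close>, \<open>t = d T / y\<close> separates the variables \<open>c\<close> and \<open>d\<close>.\<close>
  have f_subst: "f (c / x * S) (d / y * T) c d =
      k * (\<alpha> S * \<beta> T) * ((\<psi> (c * A S T) * (inverse \<gamma>\<^sub>1 * \<alpha>) c) * (\<psi> (d * B S T) * (inverse \<gamma>\<^sub>2 * \<beta>) d))"
    if "c \<in> ?U" "d \<in> ?U" for S T c d
  proof -
    have exponent: "c / x * S + d / y * T + (c + (c / x * S) * (d / y * T) * (x * (1 - y)) / c) +
        (d + (c / x * S) * (d / y * T) * (y * (1 - x)) / d) = c * A S T + d * B S T"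
      using that xy by (simp add: A_def B_def divide_simps) (simp add: algebra_simps)
    have chars: "\<alpha> (c / x * S) = \<alpha> c * inverse (\<alpha> x) * \<alpha> S" "\<beta> (d / y * T) = \<beta> d * inverse (\<beta> y) * \<beta> T"
      using \<alpha> \<beta> by (simp_all add: mult_char_mult mult_char_divide divide_inverse mult_char_inverse)
    show ?thesis
      unfolding f_def exponent chars by (simp add: k_def add mult_ac)
  qed
  have "(\<Sum>s\<in>?U. \<Sum>t\<in>?U. \<psi> (s + t) * \<alpha> s * \<beta> t *
       kloosterman \<psi> \<gamma>\<^sub>1 (s * t * (x * (1 - y))) * kloosterman \<psi> \<gamma>\<^sub>2 (s * t * (y * (1 - x)))) =
     (\<Sum>s\<in>?U. \<Sum>t\<in>?U. \<Sum>c\<in>?U. \<Sum>d\<in>?U. f s t c d)"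
    unfolding kloosterman_def f_def
    by (simp add: mult.assoc sum_product) (simp add: sum_distrib_left add mult_ac)
  also have "\<dots> = (\<Sum>c\<in>?U. \<Sum>d\<in>?U. \<Sum>s\<in>?U. \<Sum>t\<in>?U. f s t c d)"
    by (rule sum_swap2)
  also have "\<dots> = (\<Sum>c\<in>?U. \<Sum>d\<in>?U. \<Sum>S\<in>?U. \<Sum>T\<in>?U. f (c / x * S) (d / y * T) c d)"
  proof (rule sum.cong[OF refl], rule sum.cong[OF refl])
    fix c d assume cd: "c \<in> ?U" "d \<in> ?U"
    have "(\<Sum>s\<in>?U. \<Sum>t\<in>?U. f s t c d) = (\<Sum>s\<in>?U. \<Sum>T\<in>?U. f s (d / y * T) c d)"
      by (rule sum.cong[OF refl], rule sum_units_scale[symmetric]) (use cd xy in auto)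
    also have "\<dots> = (\<Sum>S\<in>?U. \<Sum>T\<in>?U. f (c / x * S) (d / y * T) c d)"
      by (rule sum_units_scale[symmetric, of _ "\<lambda>s. \<Sum>T\<in>?U. f s (d / y * T) c d"]) (use cd xy in auto)
    finally show "(\<Sum>s\<in>?U. \<Sum>t\<in>?U. f s t c d) = (\<Sum>S\<in>?U. \<Sum>T\<in>?U. f (c / x * S) (d / y * T) c d)" .
  qed
  also have "\<dots> = (\<Sum>S\<in>?U. \<Sum>T\<in>?U. \<Sum>c\<in>?U. \<Sum>d\<in>?U. f (c / x * S) (d / y * T) c d)"
    by (rule sum_swap2)
  also have "\<dots> = (\<Sum>S\<in>?U. \<Sum>T\<in>?U. \<Sum>c\<in>?U. \<Sum>d\<in>?U. k * (\<alpha> S * \<beta> T) *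
      ((\<psi> (c * A S T) * (inverse \<gamma>\<^sub>1 * \<alpha>) c) * (\<psi> (d * B S T) * (inverse \<gamma>\<^sub>2 * \<beta>) d)))"
    by (intro sum.cong refl f_subst)
  also have "\<dots> = (\<Sum>S\<in>?U. \<Sum>T\<in>?U. k * (\<alpha> S * \<beta> T) *
      ((- gauss \<psi> (inverse \<gamma>\<^sub>1 * \<alpha>) * inverse ((inverse \<gamma>\<^sub>1 * \<alpha>) (A S T))) *
       (- gauss \<psi> (inverse \<gamma>\<^sub>2 * \<beta>) * inverse ((inverse \<gamma>\<^sub>2 * \<beta>) (B S T)))))"
  proof -
    have ne': "inverse \<gamma>\<^sub>1 * \<alpha> \<noteq> triv_char" "inverse \<gamma>\<^sub>2 * \<beta> \<noteq> triv_char"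
      using inverse_times_eq_triv_char_iff \<gamma> \<alpha> \<beta> ne by blast+
    have "(\<Sum>c\<in>?U. \<psi> (c * A S T) * (inverse \<gamma>\<^sub>1 * \<alpha>) c) =
        - gauss \<psi> (inverse \<gamma>\<^sub>1 * \<alpha>) * inverse ((inverse \<gamma>\<^sub>1 * \<alpha>) (A S T))" for S T
      by (rule gauss_scale[OF mult_chars_times[OF mult_chars_inverse[OF \<gamma>(1)] \<alpha>] ne'(1)])
    moreover have "(\<Sum>d\<in>?U. \<psi> (d * B S T) * (inverse \<gamma>\<^sub>2 * \<beta>) d) =
        - gauss \<psi> (inverse \<gamma>\<^sub>2 * \<beta>) * inverse ((inverse \<gamma>\<^sub>2 * \<beta>) (B S T))" for S T
      by (rule gauss_scale[OF mult_chars_times[OF mult_chars_inverse[OF \<gamma>(2)] \<beta>] ne'(2)])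
    ultimately show ?thesis
      by (simp only: sum_distrib_left[symmetric] sum_distrib_right[symmetric])
  qed
  also have "\<dots> = gauss \<psi> (inverse \<gamma>\<^sub>1 * \<alpha>) * gauss \<psi> (inverse \<gamma>\<^sub>2 * \<beta>) * inverse (\<alpha> x) * inverse (\<beta> y) *
    (\<Sum>S\<in>?U. \<Sum>T\<in>?U. reduced_term \<alpha> \<beta> \<gamma>\<^sub>1 \<gamma>\<^sub>2 x y S T)"
    by (simp add: sum_distrib_left k_def reduced_term_def A_def B_def mult_ac)
  finally show ?thesis .
qed


section \<open>The birational substitution and the degenerate lines\<close>

text \<open>
  With \<open>S = - x u / (1 - y v)\<close> and \<open>T = - y v / (1 - x u)\<close> one finds \<open>1 - S T = r / (p q)\<close>,
  \<open>1 + S = r / q\<close> and \<open>1 + T = r / p\<close>, where \<open>p = 1 - x u\<close>, \<open>q = 1 - y v\<close>, \<open>r = 1 - x u - y v\<close>. So all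
  arguments of characters factor into \<open>u\<close>, \<open>v\<close>, \<open>1 - u\<close>, \<open>1 - v\<close>, \<open>p\<close>, \<open>q\<close>, \<open>r\<close>, and collecting
  exponents gives the summand of the theorem.
\<close>

lemma reduced_term_substitution:
  fixes \<alpha> \<beta> \<gamma>\<^sub>1 \<gamma>\<^sub>2 :: "'a::{field,finite} \<Rightarrow> qbar"
  assumes \<alpha>: "\<alpha> \<in> mult_chars" and \<beta>: "\<beta> \<in> mult_chars"
    and \<gamma>: "\<gamma>\<^sub>1 \<in> mult_chars" "\<gamma>\<^sub>2 \<in> mult_chars"
    and xy: "x \<noteq> 0" "y \<noteq> 0"
    and P: "1 - x * u \<noteq> 0" and Q: "1 - y * v \<noteq> 0"
  shows "(\<alpha> * \<beta>) (-1) * inverse (\<alpha> x) * inverse (\<beta> y) *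
      reduced_term \<alpha> \<beta> \<gamma>\<^sub>1 \<gamma>\<^sub>2 x y (- (x * u) / (1 - y * v)) (- (y * v) / (1 - x * u)) =
    \<alpha> u * \<beta> v * (inverse \<alpha> * \<gamma>\<^sub>1) (1 - u) * (inverse \<beta> * \<gamma>\<^sub>2) (1 - v)
        * (\<alpha> * inverse (\<gamma>\<^sub>1 * \<gamma>\<^sub>2)) (1 - x * u) * (\<beta> * inverse (\<gamma>\<^sub>1 * \<gamma>\<^sub>2)) (1 - y * v)
        * (inverse (\<alpha> * \<beta>) * \<gamma>\<^sub>1 * \<gamma>\<^sub>2) (1 - x * u - y * v)"
proof -
  define p q r where "p = 1 - x * u" and "q = 1 - y * v" and "r = 1 - x * u - y * v"
  have pq: "p \<noteq> 0" "q \<noteq> 0" using P Q by (simp_all add: p_def q_def)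
  define S T where "S = - (x * u) / q" and "T = - (y * v) / p"
  have ST: "1 - S * T = r / (p * q)"
    using pq by (simp add: S_def T_def divide_simps) (simp add: p_def q_def r_def algebra_simps)
  have T1: "1 + T = r / p" using pq by (simp add: T_def divide_simps) (simp add: p_def r_def)
  have S1: "1 + S = r / q" using pq by (simp add: S_def divide_simps) (simp add: q_def r_def)
  have A: "1 - S * T + S * (1 + T) / x = (1 - u) * r / (p * q)"
    unfolding ST T1 using pq xy by (simp add: S_def divide_simps) (simp add: algebra_simps)
  have B: "1 - S * T + T * (1 + S) / y = (1 - v) * r / (p * q)"
    unfolding ST S1 using pq xy by (simp add: T_def divide_simps) (simp add: algebra_simps)
  have \<alpha>S: "\<alpha> S = \<alpha> (-1) * \<alpha> x * \<alpha> u / \<alpha> q"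
    unfolding S_def mult_char_divide[OF \<alpha>] mult_char_minus[OF \<alpha>, of "x * u"] mult_char_mult[OF \<alpha>] by simp
  have \<beta>T: "\<beta> T = \<beta> (-1) * \<beta> y * \<beta> v / \<beta> p"
    unfolding T_def mult_char_divide[OF \<beta>] mult_char_minus[OF \<beta>, of "y * v"] mult_char_mult[OF \<beta>] by simp
  have sq: "\<alpha> (-1) * \<alpha> (-1) = 1" "\<beta> (-1) * \<beta> (-1) = 1"
    by (rule mult_char_minus_1_square[OF \<alpha>], rule mult_char_minus_1_square[OF \<beta>])
  have nz: "\<alpha> x \<noteq> 0" "\<beta> y \<noteq> 0" "\<alpha> p \<noteq> 0" "\<alpha> q \<noteq> 0" "\<beta> p \<noteq> 0" "\<beta> q \<noteq> 0"
    using \<alpha> \<beta> pq xy by (simp_all add: mult_char_nonzero)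
  have frac: "\<eta> (a * r / (p * q)) = \<eta> a * \<eta> r / (\<eta> p * \<eta> q)" if "\<eta> \<in> mult_chars" for \<eta> a
    using that by (simp add: mult_char_mult mult_char_divide)
  have "(\<alpha> * \<beta>) (-1) * inverse (\<alpha> x) * inverse (\<beta> y) * reduced_term \<alpha> \<beta> \<gamma>\<^sub>1 \<gamma>\<^sub>2 x y S T =
     (\<alpha> (-1) * \<alpha> (-1)) * (\<beta> (-1) * \<beta> (-1)) * (\<alpha> u * \<beta> v * (\<gamma>\<^sub>1 (1 - u) / \<alpha> (1 - u)) * (\<gamma>\<^sub>2 (1 - v) / \<beta> (1 - v))
       * (\<alpha> p / (\<gamma>\<^sub>1 p * \<gamma>\<^sub>2 p)) * (\<beta> q / (\<gamma>\<^sub>1 q * \<gamma>\<^sub>2 q)) * (\<gamma>\<^sub>1 r * \<gamma>\<^sub>2 r / (\<alpha> r * \<beta> r)))"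
    unfolding reduced_term_def A B \<alpha>S \<beta>T times_fun_apply inverse_fun_apply
      frac[OF \<alpha>] frac[OF \<beta>] frac[OF \<gamma>(1)] frac[OF \<gamma>(2)]
    using nz by (simp add: divide_inverse mult_ac) (simp add: field_simps)
  also have "\<dots> = \<alpha> u * \<beta> v * (inverse \<alpha> * \<gamma>\<^sub>1) (1 - u) * (inverse \<beta> * \<gamma>\<^sub>2) (1 - v)
        * (\<alpha> * inverse (\<gamma>\<^sub>1 * \<gamma>\<^sub>2)) p * (\<beta> * inverse (\<gamma>\<^sub>1 * \<gamma>\<^sub>2)) q
        * (inverse (\<alpha> * \<beta>) * \<gamma>\<^sub>1 * \<gamma>\<^sub>2) r"
    unfolding sq by (simp add: divide_inverse mult_ac)
  finally show ?thesis unfolding S_def T_def p_def q_def r_def .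
qed

text \<open>
  On the line \<open>S = -1\<close> the two linear coefficients are \<open>(1 + T) (x - 1) / x\<close> and \<open>1 + T\<close>, and the
  sum over \<open>T = - v\<close> is a Jacobi sum in \<open>v\<close> and \<open>1 - v\<close>.
\<close>

lemma reduced_sum_S_minus_1:
  fixes \<alpha> \<beta> \<gamma>\<^sub>1 \<gamma>\<^sub>2 :: "'a::{field,finite} \<Rightarrow> qbar"
  assumes \<alpha>: "\<alpha> \<in> mult_chars" and \<beta>: "\<beta> \<in> mult_chars"
    and \<gamma>: "\<gamma>\<^sub>1 \<in> mult_chars" "\<gamma>\<^sub>2 \<in> mult_chars" and x: "x \<noteq> 0"
  shows "(\<alpha> * \<beta>) (-1) * inverse (\<alpha> x) * inverse (\<beta> y) *
      (\<Sum>T\<in>UNIV - {0}. reduced_term \<alpha> \<beta> \<gamma>\<^sub>1 \<gamma>\<^sub>2 x y (-1) T) =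
    - (jacobi (inverse (\<alpha> * \<beta>) * \<gamma>\<^sub>1 * \<gamma>\<^sub>2) \<beta>
       * (inverse \<gamma>\<^sub>1) x * (inverse \<alpha> * \<gamma>\<^sub>1) (x - 1) * (inverse \<beta>) y)"
proof -
  let ?\<omega> = "inverse (\<alpha> * \<beta>) * \<gamma>\<^sub>1 * \<gamma>\<^sub>2"
  have \<omega>: "?\<omega> \<in> mult_chars" using \<alpha> \<beta> \<gamma> by simp
  have "(\<Sum>T\<in>UNIV - {0}. \<beta> (- T) * ?\<omega> (1 + T)) = (\<Sum>v\<in>UNIV - {0}. \<beta> v * ?\<omega> (1 - v))"
    by (rule sum.reindex_bij_witness[of _ uminus uminus]) auto
  hence jac: "jacobi ?\<omega> \<beta> = - (\<Sum>T\<in>UNIV - {0}. \<beta> (- T) * ?\<omega> (1 + T))"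
    by (simp only: jacobi_commute[of ?\<omega>] jacobi_eq_sum[OF \<omega>])
  have "(\<alpha> * \<beta>) (-1) * inverse (\<alpha> x) * inverse (\<beta> y) * reduced_term \<alpha> \<beta> \<gamma>\<^sub>1 \<gamma>\<^sub>2 x y (-1) T =
      (\<beta> (- T) * ?\<omega> (1 + T)) * ((inverse \<gamma>\<^sub>1) x * (inverse \<alpha> * \<gamma>\<^sub>1) (x - 1) * (inverse \<beta>) y)" for T
  proof -
    have A: "1 - (-1) * T + (-1) * (1 + T) / x = (1 + T) * (x - 1) / x"
      using x by (simp add: field_simps)
    have B: "1 - (-1) * T + T * (1 + (-1)) / y = 1 + T" by simp
    have sq: "\<alpha> (-1) * \<alpha> (-1) = 1" by (rule mult_char_minus_1_square[OF \<alpha>])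
    have "(\<alpha> * \<beta>) (-1) * inverse (\<alpha> x) * inverse (\<beta> y) * reduced_term \<alpha> \<beta> \<gamma>\<^sub>1 \<gamma>\<^sub>2 x y (-1) T =
       (\<alpha> (-1) * \<alpha> (-1)) * ((\<beta> (- T) * ?\<omega> (1 + T)) * ((inverse \<gamma>\<^sub>1) x * (inverse \<alpha> * \<gamma>\<^sub>1) (x - 1) * (inverse \<beta>) y))"
      unfolding reduced_term_def A B mult_char_minus[OF \<beta>, of T]
      using mult_char_nonzero[OF \<alpha> x]
      by (simp add: mult_char_mult[OF \<alpha>] mult_char_mult[OF \<gamma>(1)]
         mult_char_inverse[OF \<alpha>] mult_char_inverse[OF \<gamma>(1)] divide_inverse mult_ac)
    thus ?thesis by (simp only: sq mult_1_left)
  qed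
  thus ?thesis
    unfolding sum_distrib_left jac by (simp only: sum_distrib_right mult_minus_left minus_minus mult.assoc)
qed

lemma reduced_term_swap:
  "reduced_term \<alpha> \<beta> \<gamma>\<^sub>1 \<gamma>\<^sub>2 x y S T = reduced_term \<beta> \<alpha> \<gamma>\<^sub>2 \<gamma>\<^sub>1 y x T S"
  by (simp add: reduced_term_def mult_ac)

text \<open>
  The line \<open>T = -1\<close> is the line \<open>S = -1\<close> after exchanging the roles of \<open>(\<alpha>, \<gamma>\<^sub>1, x, S)\<close> and
  \<open>(\<beta>, \<gamma>\<^sub>2, y, T)\<close>.
\<close>

lemma reduced_sum_T_minus_1:
  fixes \<alpha> \<beta> \<gamma>\<^sub>1 \<gamma>\<^sub>2 :: "'a::{field,finite} \<Rightarrow> qbar"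
  assumes \<alpha>: "\<alpha> \<in> mult_chars" and \<beta>: "\<beta> \<in> mult_chars"
    and \<gamma>: "\<gamma>\<^sub>1 \<in> mult_chars" "\<gamma>\<^sub>2 \<in> mult_chars" and y: "y \<noteq> 0"
  shows "(\<alpha> * \<beta>) (-1) * inverse (\<alpha> x) * inverse (\<beta> y) *
      (\<Sum>S\<in>UNIV - {0}. reduced_term \<alpha> \<beta> \<gamma>\<^sub>1 \<gamma>\<^sub>2 x y S (-1)) =
    - (jacobi (inverse (\<alpha> * \<beta>) * \<gamma>\<^sub>1 * \<gamma>\<^sub>2) \<alpha>
       * (inverse \<gamma>\<^sub>2) y * (inverse \<beta> * \<gamma>\<^sub>2) (y - 1) * (inverse \<alpha>) x)"
proof -
  have "inverse (\<beta> * \<alpha>) * \<gamma>\<^sub>2 * \<gamma>\<^sub>1 = inverse (\<alpha> * \<beta>) * \<gamma>\<^sub>1 * \<gamma>\<^sub>2" by (simp add: mult_ac)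
  moreover have "(\<beta> * \<alpha>) (-1) * inverse (\<beta> y) * inverse (\<alpha> x) = (\<alpha> * \<beta>) (-1) * inverse (\<alpha> x) * inverse (\<beta> y)"
    by (simp add: mult_ac)
  ultimately show ?thesis
    using reduced_sum_S_minus_1[OF \<beta> \<alpha> \<gamma>(2,1) y, of x]
    by (simp only: reduced_term_swap[of \<alpha> \<beta>])
qed

text \<open>
  On the hyperbola \<open>S T = 1\<close> the coefficients become \<open>(1 + S) / x\<close> and \<open>(1 + S) / (S y)\<close>, and the
  sum over \<open>S\<close> is a Jacobi sum in its ratio form.
\<close>

lemma reduced_sum_hyperbola:
  fixes \<alpha> \<beta> \<gamma>\<^sub>1 \<gamma>\<^sub>2 :: "'a::{field,finite} \<Rightarrow> qbar"
  assumes \<alpha>: "\<alpha> \<in> mult_chars" and \<beta>: "\<beta> \<in> mult_chars"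
    and \<gamma>: "\<gamma>\<^sub>1 \<in> mult_chars" "\<gamma>\<^sub>2 \<in> mult_chars" and xy: "x \<noteq> 0" "y \<noteq> 0"
  shows "(\<alpha> * \<beta>) (-1) * inverse (\<alpha> x) * inverse (\<beta> y) *
      (\<Sum>S\<in>UNIV - {0}. reduced_term \<alpha> \<beta> \<gamma>\<^sub>1 \<gamma>\<^sub>2 x y S (1 / S)) =
    - ((\<alpha> * \<beta>) (-1) * jacobi (\<alpha> * inverse \<gamma>\<^sub>2) (\<beta> * inverse \<gamma>\<^sub>1)
       * (inverse \<gamma>\<^sub>1) x * (inverse \<gamma>\<^sub>2) y)"
proof -
  let ?\<eta> = "\<beta> * inverse \<gamma>\<^sub>1" and ?\<chi> = "\<alpha> * inverse \<gamma>\<^sub>2"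
  have jac: "jacobi ?\<chi> ?\<eta> = - (\<Sum>S\<in>UNIV - {0}. ?\<chi> S * inverse ((?\<eta> * ?\<chi>) (1 + S)))"
    unfolding jacobi_commute[of ?\<chi>] using \<alpha> \<beta> \<gamma> by (intro jacobi_eq_sum_ratio) auto
  have "(\<alpha> * \<beta>) (-1) * inverse (\<alpha> x) * inverse (\<beta> y) * reduced_term \<alpha> \<beta> \<gamma>\<^sub>1 \<gamma>\<^sub>2 x y S (1 / S) =
      (?\<chi> S * inverse ((?\<eta> * ?\<chi>) (1 + S))) * ((\<alpha> * \<beta>) (-1) * (inverse \<gamma>\<^sub>1) x * (inverse \<gamma>\<^sub>2) y)"
    if "S \<in> UNIV - {0}" for S
  proof -
    have A: "1 - S * (1 / S) + S * (1 + 1 / S) / x = (1 + S) / x"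
      using that xy by (simp add: field_simps)
    have B: "1 - S * (1 / S) + 1 / S * (1 + S) / y = (1 + S) / (S * y)"
      using that xy by simp
    have nz: "\<alpha> x \<noteq> 0" "\<beta> y \<noteq> 0" "\<beta> S \<noteq> 0"
      using that xy \<alpha> \<beta> by (simp_all add: mult_char_nonzero)
    show ?thesis
      unfolding reduced_term_def A B using nz
      by (simp add: mult_char_mult[OF \<alpha>] mult_char_mult[OF \<beta>] mult_char_mult[OF \<gamma>(1)] mult_char_mult[OF \<gamma>(2)]
        mult_char_inverse[OF \<alpha>] mult_char_inverse[OF \<beta>] mult_char_inverse[OF \<gamma>(1)] mult_char_inverse[OF \<gamma>(2)]
        divide_inverse mult_ac) (simp add: field_simps)
  qed
  hence "(\<alpha> * \<beta>) (-1) * inverse (\<alpha> x) * inverse (\<beta> y) *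
      (\<Sum>S\<in>UNIV - {0}. reduced_term \<alpha> \<beta> \<gamma>\<^sub>1 \<gamma>\<^sub>2 x y S (1 / S)) =
     (\<Sum>S\<in>UNIV - {0}. ?\<chi> S * inverse ((?\<eta> * ?\<chi>) (1 + S))) * ((\<alpha> * \<beta>) (-1) * (inverse \<gamma>\<^sub>1) x * (inverse \<gamma>\<^sub>2) y)"
    unfolding sum_distrib_left sum_distrib_right by (intro sum.cong refl)
  thus ?thesis unfolding jac by simp
qed

text \<open>
  The three curves \<open>S T = 1\<close>, \<open>S = -1\<close> and \<open>T = -1\<close> meet pairwise in the single point \<open>(-1, -1)\<close>.
  If \<open>H\<close> vanishes there, it does no harm that the three sums on the right all pass through it.
\<close>

lemma sum_split_degenerate:
  fixes H :: "'a::{field,finite} \<Rightarrow> 'a \<Rightarrow> 'b::comm_monoid_add"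
  assumes H: "H (-1) (-1) = 0"
  shows "(\<Sum>S\<in>UNIV - {0}. \<Sum>T\<in>UNIV - {0}. H S T) =
    (\<Sum>(S, T) \<in> {(S, T). S \<noteq> 0 \<and> T \<noteq> 0 \<and> S \<noteq> -1 \<and> T \<noteq> -1 \<and> S * T \<noteq> 1}. H S T)
    + (\<Sum>S\<in>UNIV - {0}. H S (1 / S)) + (\<Sum>T\<in>UNIV - {0}. H (-1) T) + (\<Sum>S\<in>UNIV - {0}. H S (-1))"
proof -
  let ?U = "UNIV - {0::'a}"
  define D where "D = {(S :: 'a, T). S \<noteq> 0 \<and> T \<noteq> 0 \<and> S \<noteq> -1 \<and> T \<noteq> -1 \<and> S * T \<noteq> 1}"
  define L0 where "L0 = (\<lambda>S :: 'a. (S, 1 / S)) ` (?U - {-1})"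
  define L1 where "L1 = (\<lambda>T :: 'a. (-1 :: 'a, T)) ` (?U - {-1})"
  define L2 where "L2 = (\<lambda>S :: 'a. (S, -1 :: 'a)) ` (?U - {-1})"
  let ?h = "\<lambda>(S, T). H S T"
  have neg: "1 / S = - 1 \<longleftrightarrow> S = - 1" "- 1 = 1 / S \<longleftrightarrow> S = - 1" if "S \<noteq> 0" for S :: 'a
    using that by (auto simp: field_simps dest: arg_cong[where f = uminus])
  have disj: "D \<inter> L0 = {}" "(D \<union> L0) \<inter> L1 = {}" "(D \<union> L0 \<union> L1) \<inter> L2 = {}"
    by (auto simp: D_def L0_def L1_def L2_def neg)
  have cover: "?U \<times> ?U = insert (-1, -1) (D \<union> L0 \<union> L1 \<union> L2)"
    by (auto simp: D_def L0_def L1_def L2_def image_iff field_simps)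
  have line: "sum ?h ((\<lambda>s. (f s, g s)) ` (?U - {-1})) = (\<Sum>s\<in>?U. H (f s) (g s))"
    if "inj_on (\<lambda>s. (f s, g s)) (?U - {-1})" "f (-1) = -1" "g (-1) = -1" for f g :: "'a \<Rightarrow> 'a"
  proof -
    have "sum ?h ((\<lambda>s. (f s, g s)) ` (?U - {-1})) = (\<Sum>s\<in>?U - {-1}. H (f s) (g s))"
      using that(1) by (simp add: sum.reindex)
    also have "\<dots> = (\<Sum>s\<in>?U. H (f s) (g s))"
      by (rule sum.mono_neutral_left) (use that H in auto)
    finally show ?thesis .
  qed
  have "(\<Sum>S\<in>?U. \<Sum>T\<in>?U. H S T) = sum ?h (?U \<times> ?U)"
    by (rule sum.cartesian_product)
  also have "\<dots> = sum ?h (D \<union> L0 \<union> L1 \<union> L2)"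
    unfolding cover by (rule sum.mono_neutral_right) (use H in auto)
  also have "\<dots> = sum ?h D + sum ?h L0 + sum ?h L1 + sum ?h L2"
    by (simp add: sum.union_disjoint disj)
  also have "sum ?h L0 = (\<Sum>S\<in>?U. H S (1 / S))"
    unfolding L0_def by (rule line) (auto simp: inj_on_def)
  also have "sum ?h L1 = (\<Sum>T\<in>?U. H (-1) T)"
    unfolding L1_def by (rule line) (auto simp: inj_on_def)
  also have "sum ?h L2 = (\<Sum>S\<in>?U. H S (-1))"
    unfolding L2_def by (rule line) (auto simp: inj_on_def)
  finally show ?thesis unfolding D_def .
qed

text \<open>
  The inverse substitution is \<open>x u = - S (1 + T) / (1 - S T)\<close>, \<open>y v = - T (1 + S) / (1 - S T)\<close>, obtained
  by solving the two equations \<open>x u = - S (1 - y v)\<close> and \<open>y v = - T (1 - x u)\<close>. The curves removed on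
  either side are exactly the zeros of the denominators and of \<open>1 + S\<close>, \<open>1 + T\<close>, \<open>1 - x u - y v\<close>.
\<close>

lemma sum_birational_substitution:
  fixes H :: "'a::{field,finite} \<Rightarrow> 'a \<Rightarrow> 'b::comm_monoid_add"
  assumes xy: "x \<noteq> 0" "y \<noteq> 0"
  shows "(\<Sum>(S, T) \<in> {(S, T). S \<noteq> 0 \<and> T \<noteq> 0 \<and> S \<noteq> -1 \<and> T \<noteq> -1 \<and> S * T \<noteq> 1}. H S T) =
    (\<Sum>(u, v) \<in> {(u, v). u \<noteq> 0 \<and> v \<noteq> 0 \<and> 1 - x * u \<noteq> 0 \<and> 1 - y * v \<noteq> 0 \<and> 1 - x * u - y * v \<noteq> 0}.
      H (- (x * u) / (1 - y * v)) (- (y * v) / (1 - x * u)))" (is "sum _ ?D = sum _ ?E")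
proof (rule sum.reindex_bij_witness[of _
    "\<lambda>(u, v). (- (x * u) / (1 - y * v), - (y * v) / (1 - x * u))"
    "\<lambda>(S, T). (- S * (1 + T) / (x * (1 - S * T)), - T * (1 + S) / (y * (1 - S * T)))"])
  fix p :: "'a \<times> 'a" assume "p \<in> ?D"
  then obtain S T where p: "p = (S, T)" "S \<noteq> 0" "T \<noteq> 0" "S \<noteq> -1" "T \<noteq> -1" "S * T \<noteq> 1" by auto
  define u v where "u = - S * (1 + T) / (x * (1 - S * T))" and "v = - T * (1 + S) / (y * (1 - S * T))"
  have nz: "1 - S * T \<noteq> 0" "1 + S \<noteq> 0" "1 + T \<noteq> 0"
    using p by (auto simp: add_eq_0_iff)
  have 1: "1 - x * u = (1 + S) / (1 - S * T)" "1 - y * v = (1 + T) / (1 - S * T)"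
    using nz xy by (simp_all add: u_def v_def divide_simps) (simp_all add: algebra_simps)
  have 2: "1 - x * u - y * v = (1 + S) * (1 + T) / (1 - S * T)"
    unfolding 1 using nz xy by (simp add: v_def divide_simps) (simp add: algebra_simps)
  have S: "- (x * u) / (1 - y * v) = S"
    unfolding 1 using nz xy by (simp add: u_def)
  have T: "- (y * v) / (1 - x * u) = T"
    unfolding 1 using nz xy by (simp add: v_def)
  have "u \<noteq> 0" "v \<noteq> 0" using nz p xy by (simp_all add: u_def v_def)
  moreover have "1 - x * u \<noteq> 0" "1 - y * v \<noteq> 0" unfolding 1 using nz by simp_all
  moreover have "1 - x * u - y * v \<noteq> 0" unfolding 2 using nz by simp
  ultimately have uv: "u \<noteq> 0 \<and> v \<noteq> 0 \<and> 1 - x * u \<noteq> 0 \<and> 1 - y * v \<noteq> 0 \<and> 1 - x * u - y * v \<noteq> 0" by blast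
  show "(case (case p of (S, T) \<Rightarrow> (- S * (1 + T) / (x * (1 - S * T)), - T * (1 + S) / (y * (1 - S * T))))
        of (u, v) \<Rightarrow> (- (x * u) / (1 - y * v), - (y * v) / (1 - x * u))) = p"
    unfolding p(1) prod.case u_def[symmetric] v_def[symmetric] S T ..
  show "(case p of (S, T) \<Rightarrow> (- S * (1 + T) / (x * (1 - S * T)), - T * (1 + S) / (y * (1 - S * T)))) \<in> ?E"
    unfolding p(1) prod.case u_def[symmetric] v_def[symmetric] mem_Collect_eq using uv by blast
  show "(case (case p of (S, T) \<Rightarrow> (- S * (1 + T) / (x * (1 - S * T)), - T * (1 + S) / (y * (1 - S * T))))
        of (u, v) \<Rightarrow> H (- (x * u) / (1 - y * v)) (- (y * v) / (1 - x * u))) = (case p of (S, T) \<Rightarrow> H S T)"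
    unfolding p(1) prod.case u_def[symmetric] v_def[symmetric] S T ..
next
  fix w :: "'a \<times> 'a" assume "w \<in> ?E"
  then obtain u v where w: "w = (u, v)" "u \<noteq> 0" "v \<noteq> 0" "1 - x * u \<noteq> 0" "1 - y * v \<noteq> 0" "1 - x * u - y * v \<noteq> 0"
    by auto
  define p q r where "p = 1 - x * u" and "q = 1 - y * v" and "r = 1 - x * u - y * v"
  have nz: "p \<noteq> 0" "q \<noteq> 0" "r \<noteq> 0" using w by (simp_all add: p_def q_def r_def)
  define S T where "S = - (x * u) / q" and "T = - (y * v) / p"
  have ST: "1 - S * T = r / (p * q)"
    using nz by (simp add: S_def T_def divide_simps) (simp add: p_def q_def r_def algebra_simps)
  have T1: "1 + T = r / p" using nz by (simp add: T_def divide_simps) (simp add: p_def r_def)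
  have S1: "1 + S = r / q" using nz by (simp add: S_def divide_simps) (simp add: q_def r_def)
  have u: "- S * (1 + T) / (x * (1 - S * T)) = u" and v: "- T * (1 + S) / (y * (1 - S * T)) = v"
    unfolding ST T1 S1 using nz xy by (simp_all add: S_def T_def)
  show "(case (case w of (u, v) \<Rightarrow> (- (x * u) / (1 - y * v), - (y * v) / (1 - x * u)))
        of (S, T) \<Rightarrow> (- S * (1 + T) / (x * (1 - S * T)), - T * (1 + S) / (y * (1 - S * T)))) = w"
    unfolding w(1) prod.case p_def[symmetric] q_def[symmetric] S_def[symmetric] T_def[symmetric] u v ..
  have "S \<noteq> 0 \<and> T \<noteq> 0 \<and> S \<noteq> -1 \<and> T \<noteq> -1 \<and> S * T \<noteq> 1"
    using S1 T1 ST nz w xy by (auto simp: S_def T_def)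
  thus "(case w of (u, v) \<Rightarrow> (- (x * u) / (1 - y * v), - (y * v) / (1 - x * u))) \<in> ?D"
    unfolding w(1) prod.case p_def[symmetric] q_def[symmetric] S_def[symmetric] T_def[symmetric]
    by blast
qed


section \<open>The double-sum formula for F4\<close>

theorem theorem3p12:
  fixes \<psi> \<alpha> \<beta> \<gamma>\<^sub>1 \<gamma>\<^sub>2 :: "'a::{field,finite} \<Rightarrow> qbar"
    and x y :: 'a
  assumes "nontriv_additive_char \<psi>"
    and "\<alpha> \<in> mult_chars" "\<beta> \<in> mult_chars" "\<gamma>\<^sub>1 \<in> mult_chars" "\<gamma>\<^sub>2 \<in> mult_chars"
    and "\<alpha> \<notin> {triv_char, \<gamma>\<^sub>1, \<gamma>\<^sub>2}" "\<beta> \<notin> {triv_char, \<gamma>\<^sub>1, \<gamma>\<^sub>2}"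
    and "x \<in> UNIV - {0} - {1}" "y \<in> UNIV - {0} - {1}"
  defines "J \<equiv> jacobi \<alpha> (inverse \<alpha> * \<gamma>\<^sub>1) * jacobi \<beta> (inverse \<beta> * \<gamma>\<^sub>2)"
    and "S\<^sub>0 \<equiv> (\<alpha> * \<beta>) (-1) * jacobi (\<alpha> * inverse \<gamma>\<^sub>2) (\<beta> * inverse \<gamma>\<^sub>1)
                * (inverse \<gamma>\<^sub>1) x * (inverse \<gamma>\<^sub>2) y"
    and "S\<^sub>1 \<equiv> jacobi (inverse (\<alpha> * \<beta>) * \<gamma>\<^sub>1 * \<gamma>\<^sub>2) \<beta>
                * (inverse \<gamma>\<^sub>1) x * (inverse \<alpha> * \<gamma>\<^sub>1) (x - 1) * (inverse \<beta>) y"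
    and "S\<^sub>2 \<equiv> jacobi (inverse (\<alpha> * \<beta>) * \<gamma>\<^sub>1 * \<gamma>\<^sub>2) \<alpha>
                * (inverse \<gamma>\<^sub>2) y * (inverse \<beta> * \<gamma>\<^sub>2) (y - 1) * (inverse \<alpha>) x"
  shows "J * F4 \<psi> \<alpha> \<beta> \<gamma>\<^sub>1 \<gamma>\<^sub>2 (x * (1 - y)) (y * (1 - x)) =
    (\<Sum>u\<in>UNIV - {0}. \<Sum>v\<in>UNIV - {0}.
        \<alpha> u * \<beta> v * (inverse \<alpha> * \<gamma>\<^sub>1) (1 - u) * (inverse \<beta> * \<gamma>\<^sub>2) (1 - v)
        * (\<alpha> * inverse (\<gamma>\<^sub>1 * \<gamma>\<^sub>2)) (1 - x * u) * (\<beta> * inverse (\<gamma>\<^sub>1 * \<gamma>\<^sub>2)) (1 - y * v)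
        * (inverse (\<alpha> * \<beta>) * \<gamma>\<^sub>1 * \<gamma>\<^sub>2) (1 - x * u - y * v))
    - S\<^sub>0 - S\<^sub>1 - S\<^sub>2"
proof -
  note \<psi> = assms(1) and \<alpha> = assms(2) and \<beta> = assms(3) and \<gamma> = assms(4,5)
  have xy: "x \<noteq> 0" "y \<noteq> 0" "x \<noteq> 1" "y \<noteq> 1" and ne: "\<alpha> \<noteq> triv_char" "\<alpha> \<noteq> \<gamma>\<^sub>1" "\<beta> \<noteq> triv_char" "\<beta> \<noteq> \<gamma>\<^sub>2"
    using assms(6-9) by auto
  let ?U = "UNIV - {0::'a}" and ?q = "of_nat CARD('a) :: qbar"
  let ?H = "reduced_term \<alpha> \<beta> \<gamma>\<^sub>1 \<gamma>\<^sub>2 x y"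
  define F where "F u v = \<alpha> u * \<beta> v * (inverse \<alpha> * \<gamma>\<^sub>1) (1 - u) * (inverse \<beta> * \<gamma>\<^sub>2) (1 - v)
        * (\<alpha> * inverse (\<gamma>\<^sub>1 * \<gamma>\<^sub>2)) (1 - x * u) * (\<beta> * inverse (\<gamma>\<^sub>1 * \<gamma>\<^sub>2)) (1 - y * v)
        * (inverse (\<alpha> * \<beta>) * \<gamma>\<^sub>1 * \<gamma>\<^sub>2) (1 - x * u - y * v)" for u v
  define k where "k = (\<alpha> * \<beta>) (-1) * inverse (\<alpha> x) * inverse (\<beta> y)"
  \<comment> \<open>The Jacobi sums in \<open>J\<close> cancel \<open>gauss \<psi> \<alpha>\<close>, \<open>gauss \<psi> \<beta>\<close> and the two \<open>gauss_circ\<close> factors, and bring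
      in the Gauss sums that pair by reflection with those from the sums over \<open>c\<close> and \<open>d\<close>.\<close>
  have main: "J * F4 \<psi> \<alpha> \<beta> \<gamma>\<^sub>1 \<gamma>\<^sub>2 (x * (1 - y)) (y * (1 - x)) = k * (\<Sum>S\<in>?U. \<Sum>T\<in>?U. ?H S T)"
  proof -
    have prod: "\<eta> * (inverse \<eta> * \<chi>) = \<chi>" if "\<eta> \<in> mult_chars" "\<chi> \<in> mult_chars" for \<eta> \<chi> :: "'a \<Rightarrow> qbar"
    proof
      fix z show "(\<eta> * (inverse \<eta> * \<chi>)) z = \<chi> z"
        using that mult_char_nonzero[of \<eta> z] mult_char_0[of \<chi>] by (cases "z = 0") auto
    qed
    have jac: "jacobi \<eta> (inverse \<eta> * \<chi>) * gauss_circ \<psi> \<chi> = gauss \<psi> \<eta> * gauss \<psi> (inverse \<eta> * \<chi>)"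
      if "\<eta> \<in> mult_chars" "\<chi> \<in> mult_chars" "\<eta> \<noteq> triv_char" for \<eta> \<chi>
      using jacobi_mult_gauss_circ[OF \<psi> that(1,3), of "inverse \<eta> * \<chi>"] that by (simp add: prod)
    have reflection: "gauss \<psi> (inverse \<eta> * \<chi>) * gauss \<psi> (inverse \<chi> * \<eta>) = \<eta> (-1) * \<chi> (-1) * ?q"
      if "\<eta> \<in> mult_chars" "\<chi> \<in> mult_chars" "\<eta> \<noteq> \<chi>" for \<eta> \<chi> :: "'a \<Rightarrow> qbar"
    proof -
      have "inverse (inverse \<chi> * \<eta>) = inverse \<eta> * \<chi>" by (simp add: fun_eq_iff)
      moreover have "inverse (\<chi> (- 1)) = \<chi> (- 1)"
        by (rule inverse_unique) (rule mult_char_minus_1_square[OF that(2)])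
      moreover have "inverse \<chi> * \<eta> \<noteq> triv_char" using inverse_times_eq_triv_char_iff that by blast
      ultimately show ?thesis
        using gauss_mult_gauss_inverse[OF \<psi>, of "inverse \<chi> * \<eta>"] that by (simp add: mult_ac)
    qed
    have nz: "gauss \<psi> \<alpha> \<noteq> 0" "gauss \<psi> \<beta> \<noteq> 0"
      using gauss_nonzero[OF \<psi>] \<alpha> \<beta> by auto
    have sq: "\<gamma>\<^sub>1 (-1) * \<gamma>\<^sub>1 (-1) = 1" "\<gamma>\<^sub>2 (-1) * \<gamma>\<^sub>2 (-1) = 1"
      by (rule mult_char_minus_1_square[OF \<gamma>(1)], rule mult_char_minus_1_square[OF \<gamma>(2)])
    let ?R = "\<Sum>S\<in>?U. \<Sum>T\<in>?U. ?H S T"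
    have "J * F4 \<psi> \<alpha> \<beta> \<gamma>\<^sub>1 \<gamma>\<^sub>2 (x * (1 - y)) (y * (1 - x)) =
        (jacobi \<alpha> (inverse \<alpha> * \<gamma>\<^sub>1) * gauss_circ \<psi> \<gamma>\<^sub>1) * (jacobi \<beta> (inverse \<beta> * \<gamma>\<^sub>2) * gauss_circ \<psi> \<gamma>\<^sub>2) *
        (gauss \<psi> (inverse \<gamma>\<^sub>1 * \<alpha>) * gauss \<psi> (inverse \<gamma>\<^sub>2 * \<beta>)) *
        (\<gamma>\<^sub>1 (-1) * \<gamma>\<^sub>2 (-1) * inverse (\<alpha> x) * inverse (\<beta> y)) / (gauss \<psi> \<alpha> * gauss \<psi> \<beta> * ?q ^ 2) * ?R"
      using F4_eq_kloosterman_sum[OF \<psi> \<gamma>, of "x * (1 - y)" "y * (1 - x)" \<alpha> \<beta>] xy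
      by (simp add: J_def kloosterman_sum_eq_reduced_sum[OF \<psi> \<alpha> \<beta> \<gamma> ne(2,4)])
    also have "\<dots> = (gauss \<psi> (inverse \<alpha> * \<gamma>\<^sub>1) * gauss \<psi> (inverse \<gamma>\<^sub>1 * \<alpha>)) *
        (gauss \<psi> (inverse \<beta> * \<gamma>\<^sub>2) * gauss \<psi> (inverse \<gamma>\<^sub>2 * \<beta>)) *
        (\<gamma>\<^sub>1 (-1) * \<gamma>\<^sub>2 (-1) * inverse (\<alpha> x) * inverse (\<beta> y)) / ?q ^ 2 * ?R"
      unfolding jac[OF \<alpha> \<gamma>(1) ne(1)] jac[OF \<beta> \<gamma>(2) ne(3)] using nz by simp
    also have "\<dots> = (\<gamma>\<^sub>1 (-1) * \<gamma>\<^sub>1 (-1)) * (\<gamma>\<^sub>2 (-1) * \<gamma>\<^sub>2 (-1)) * k * ?R"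
      unfolding reflection[OF \<alpha> \<gamma>(1) ne(2)] reflection[OF \<beta> \<gamma>(2) ne(4)]
      by (simp add: k_def power2_eq_square)
    finally show ?thesis by (simp only: sq mult_1_left)
  qed
  have generic: "k * (\<Sum>(S, T) \<in> {(S, T). S \<noteq> 0 \<and> T \<noteq> 0 \<and> S \<noteq> -1 \<and> T \<noteq> -1 \<and> S * T \<noteq> 1}. ?H S T) =
      (\<Sum>u\<in>?U. \<Sum>v\<in>?U. F u v)"
  proof -
    let ?E = "{(u, v). u \<noteq> 0 \<and> v \<noteq> 0 \<and> 1 - x * u \<noteq> 0 \<and> 1 - y * v \<noteq> 0 \<and> 1 - x * u - y * v \<noteq> 0}"
    have "k * (\<Sum>(S, T) \<in> {(S, T). S \<noteq> 0 \<and> T \<noteq> 0 \<and> S \<noteq> -1 \<and> T \<noteq> -1 \<and> S * T \<noteq> 1}. ?H S T) =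
        (\<Sum>(u, v) \<in> ?E. k * ?H (- (x * u) / (1 - y * v)) (- (y * v) / (1 - x * u)))"
      unfolding sum_birational_substitution[OF xy(1,2)] by (simp add: sum_distrib_left case_prod_unfold)
    also have "\<dots> = (\<Sum>(u, v) \<in> ?E. F u v)"
      using reduced_term_substitution[OF \<alpha> \<beta> \<gamma> xy(1,2)] by (intro sum.cong refl) (auto simp: k_def F_def)
    \<comment> \<open>Each curve that is left out of \<open>?E\<close> is a zero of one of the characters in \<open>F\<close>.\<close>
    also have "\<dots> = (\<Sum>(u, v) \<in> ?U \<times> ?U. F u v)"
      by (rule sum.mono_neutral_left)
         (auto simp: F_def mult_char_0[OF \<alpha>] mult_char_0[OF \<beta>] mult_char_0[OF \<gamma>(1)])
    finally show ?thesis by (simp only: sum.cartesian_product)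
  qed
  have "?H (-1) (-1) = 0"
    by (simp add: reduced_term_def mult_char_0[OF \<gamma>(1)])
  from main[unfolded sum_split_degenerate[of ?H, OF this]] show ?thesis
    unfolding distrib_left generic
      reduced_sum_S_minus_1[OF \<alpha> \<beta> \<gamma> xy(1), of y, folded k_def]
      reduced_sum_T_minus_1[OF \<alpha> \<beta> \<gamma> xy(2), of x, folded k_def]
      reduced_sum_hyperbola[OF \<alpha> \<beta> \<gamma> xy(1,2), folded k_def]
    unfolding S\<^sub>0_def S\<^sub>1_def S\<^sub>2_def F_def by simp
qed

end
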